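(* Let $0<\kappa<1$, $\lambda=\sqrt{1-\kappa^2}$. For $\phi$ near $0$ define $$u(\phi)=\int_0^{\phi} F\!\left(\tfrac14,\tfrac34;\tfrac12;\kappa^2\sin^2\theta\right)\,\mathrm{d}\theta ,$$ let $u\mapsto\phi(u)$ be the local inverse near $0$ with $\phi(0)=0$, let $\psi=\psi(u)$ be defined near $u=0$ with $\psi(0)=0$ and $\sin\psi=\kappa\sin\phi$, and let $d$ be the elliptic function extending $\cos\psi$. Let $2\omega$ and $2i\omega'$ ($\omega,\omega'>0$) be the fundamental periods of the (rectangular) period lattice of the Weierstrass function $\wp(\,\cdot\,;g_2,g_3)$ with $g_2=\tfrac43-\kappa^2$, $g_3=\tfrac{8}{27}-\tfrac13\kappa^2$. Then $d$ has a double pole at $i\omega'$ (and its poles are exactly the points congruent to $i\omega'$ modulo the lattice), and $d$ takes the value $-\lambda$ at $\omega+i\omega'$ and the value $\lambda$ at $\omega$, each with multiplicity two.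
   Context: $F(a,b;c;z)$ denotes the Gauss hypergeometric function ${}_2F_1(a,b;c;z)$. The function $\cos\psi$, defined near $u=0$, extends to an elliptic function $d$ on $\mathbb{C}$. $\wp(\cdot;g_2,g_3)$ is the Weierstrass function satisfying $(\wp')^2=4\wp^3-g_2\wp-g_3$ with a double pole at $0$. *)

theory Defs
  imports "HOL-Complex_Analysis.Complex_Analysis"
begin

text \<open>Gauss hypergeometric series 2F1(a,b;c;z) (meaningful for norm z < 1).\<close>
definition hyp2F1 :: "complex \<Rightarrow> complex \<Rightarrow> complex \<Rightarrow> complex \<Rightarrow> complex" where
  "hyp2F1 a b c z =
     (\<Sum>n. pochhammer a n * pochhammer b n / (pochhammer c n * fact n) * z ^ n)"

definition u_int :: "real \<Rightarrow> complex \<Rightarrow> complex" where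
  "u_int k phi = contour_integral (linepath 0 phi)
      (\<lambda>t. hyp2F1 (1/4) (3/4) (1/2) ((complex_of_real k)\<^sup>2 * (sin t)\<^sup>2))"

definition lattice :: "real \<Rightarrow> real \<Rightarrow> complex set" where
  "lattice w w' = {of_int m * (2 * complex_of_real w) + of_int n * (2 * \<i> * complex_of_real w') | m n. True}"

definition lattice_g2 :: "complex set \<Rightarrow> complex" where
  "lattice_g2 L = 60 * infsum (\<lambda>p. 1 / p ^ 4) (L - {0})"

definition lattice_g3 :: "complex set \<Rightarrow> complex" where
  "lattice_g3 L = 140 * infsum (\<lambda>p. 1 / p ^ 6) (L - {0})"

definition elliptic_fun :: "(complex \<Rightarrow> complex) \<Rightarrow> bool" where
  "elliptic_fun f \<longleftrightarrow> f nicely_meromorphic_on UNIV \<and>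
     (\<exists>p1 p2. p1 \<noteq> 0 \<and> p2 \<noteq> 0 \<and> Im (p2 / p1) \<noteq> 0 \<and>
        (\<forall>z. f (z + p1) = f z \<and> f (z + p2) = f z))"

end

theory Submission
  imports Defs
begin

text \<open>
  The series \<open>F(1/4, 3/4; 1/2; s\<^sup>2)\<close> is the even part of \<open>(1 - s) powr (- 1/2)\<close>, so for \<open>s = sin \<psi>\<close>
  it equals \<open>cos (\<psi>/2) / cos \<psi>\<close>. Hence near \<open>0\<close> the function \<open>d = cos \<psi>\<close> satisfies
  \<open>d'' = \<lambda>\<^sup>2 + 2 d - 3 d\<^sup>2\<close> with \<open>d(0) = 1\<close>, \<open>d'(0) = 0\<close>, and \<open>y = (1/3 - d) / 2\<close> satisfies the Weierstrass
  equation \<open>y'' = 6 y\<^sup>2 - g\<^sub>2 / 2\<close> with \<open>y(0) = - 1/3\<close>, \<open>y'(0) = 0\<close>. The number \<open>- 1/3\<close> is the smallest root of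
  \<open>4 t\<^sup>3 - g\<^sub>2 t - g\<^sub>3\<close>, the others being \<open>1/6 \<plusminus> \<lambda>/2\<close>. For a rectangular lattice the smallest
  root is the value of \<open>\<wp>\<close> at \<open>\<i> \<omega>'\<close>, the largest one the value at \<open>\<omega>\<close>, because \<open>\<wp>\<close> runs from \<open>\<infinity>\<close> to
  \<open>\<wp>(\<omega>)\<close> along the real axis and from \<open>- \<infinity>\<close> to \<open>\<wp>(\<i> \<omega>')\<close> along the imaginary axis. By uniqueness
  \<open>d(u) = 1/3 - 2 \<wp>(u + \<i> \<omega>')\<close>, and the claims are read off at the half periods.
\<close>

subsection \<open>Rectangular lattices\<close>

text \<open>The integers are covered by two images of the naturals, and on each of them the series
  is a shifted p-series with exponent beyond the harmonic one.\<close>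

lemma summable_on_int_powr:
  assumes "s < -1"
  shows "(\<lambda>n::int. (1 + \<bar>real_of_int n\<bar>) powr s) summable_on UNIV"
proof -
  have "summable (\<lambda>n. real (Suc n) powr s)"
    using assms by (subst summable_Suc_iff) (simp add: summable_real_powr_iff)
  then have *: "(\<lambda>n. real (Suc n) powr s) summable_on UNIV"
    by (subst summable_on_UNIV_nonneg_real_iff) auto
  have 1: "(\<lambda>n::int. (1 + \<bar>real_of_int n\<bar>) powr s) summable_on range int"
    using * by (subst summable_on_reindex) (auto simp: o_def add.commute)
  have 2: "(\<lambda>n::int. (1 + \<bar>real_of_int n\<bar>) powr s) summable_on range (\<lambda>n. - int n)"
    using * by (subst summable_on_reindex) (auto simp: o_def add.commute inj_on_def)
  have "(UNIV :: int set) = range int \<union> range (\<lambda>n. - int n)"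
    by (metis (no_types, lifting) UNIV_eq_I UnCI int_cases2 rangeI)
  with summable_on_union[OF 1 2] show ?thesis by simp
qed

lemma summable_on_product_nonneg:
  fixes f g :: "'a \<Rightarrow> real"
  assumes f: "f summable_on UNIV" and g: "g summable_on UNIV"
    and nonneg: "\<And>x. f x \<ge> 0" "\<And>x. g x \<ge> 0"
  shows "(\<lambda>(x, y). f x * g y) summable_on UNIV"
proof -
  have "(\<lambda>(x, y). f x * g y) summable_on Sigma UNIV (\<lambda>_. UNIV)"
  proof (rule summable_on_SigmaI)
    show "((\<lambda>y. case (x, y) of (x, y) \<Rightarrow> f x * g y) has_sum f x * infsum g UNIV) UNIV" for x
      using g by (auto intro!: has_sum_cmult_right)
    show "(\<lambda>x. f x * infsum g UNIV) summable_on UNIV"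
      by (intro summable_on_cmult_left f)
  qed (use nonneg in auto)
  then show ?thesis by simp
qed

locale rect_lattice =
  fixes w w' :: real
  assumes w_pos: "0 < w" and w'_pos: "0 < w'"
begin

abbreviation "L \<equiv> lattice w w'"

text \<open>Enumeration of the lattice by pairs of integers; it is injective, so sums over
  \<open>L\<close> can be reindexed as sums over pairs.\<close>

definition lpt :: "int \<times> int \<Rightarrow> complex" where
  "lpt = (\<lambda>(m, n). of_int m * (2 * of_real w) + of_int n * (2 * \<i> * of_real w'))"

lemma L_eq: "L = range lpt"
  unfolding lattice_def lpt_def by auto

lemma Re_lpt [simp]: "Re (lpt (m, n)) = 2 * w * of_int m"
  and Im_lpt [simp]: "Im (lpt (m, n)) = 2 * w' * of_int n"
  by (auto simp: lpt_def)

lemma inj_lpt: "inj lpt"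
  by (rule injI) (use w_pos w'_pos in \<open>auto simp: complex_eq_iff\<close>)

text \<open>Since the lattice is rectangular, membership separates into one condition on the real
  part and one on the imaginary part.\<close>

lemma L_iff: "z \<in> L \<longleftrightarrow> (\<exists>m n. Re z = 2 * w * of_int m \<and> Im z = 2 * w' * of_int n)"
  unfolding L_eq by (auto simp: complex_eq_iff image_iff)

lemma zero_in_L [simp]: "0 \<in> L"
  unfolding L_iff by (auto intro!: exI[of _ 0])

lemma minus_in_L_iff [simp]: "- p \<in> L \<longleftrightarrow> p \<in> L"
proof -
  have "- p \<in> L" if "p \<in> L" for p
  proof -
    from that obtain m n where "Re p = 2 * w * of_int m" "Im p = 2 * w' * of_int n"
      by (auto simp: L_iff)
    then show ?thesis unfolding L_iff by (intro exI[of _ "-m"] exI[of _ "-n"]) auto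
  qed
  from this[of p] this[of "-p"] show ?thesis by auto
qed

lemma add_in_L: "p \<in> L \<Longrightarrow> q \<in> L \<Longrightarrow> p + q \<in> L"
proof -
  assume "p \<in> L" "q \<in> L"
  then obtain m n m' n' where "Re p = 2 * w * of_int m" "Im p = 2 * w' * of_int n"
    "Re q = 2 * w * of_int m'" "Im q = 2 * w' * of_int n'"
    by (auto simp: L_iff)
  then show ?thesis
    unfolding L_iff by (intro exI[of _ "m + m'"] exI[of _ "n + n'"]) (auto simp: algebra_simps)
qed

lemma diff_in_L: "p \<in> L \<Longrightarrow> q \<in> L \<Longrightarrow> p - q \<in> L"
  using add_in_L[of p "-q"] by simp

lemma add_in_L_iff: "p \<in> L \<Longrightarrow> z + p \<in> L \<longleftrightarrow> z \<in> L"
  using add_in_L[of z p] diff_in_L[of "z + p" p] by auto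

lemma cnj_in_L_iff [simp]: "cnj p \<in> L \<longleftrightarrow> p \<in> L"
proof -
  have "cnj p \<in> L" if "p \<in> L" for p
  proof -
    from that obtain m n where "Re p = 2 * w * of_int m" "Im p = 2 * w' * of_int n"
      by (auto simp: L_iff)
    then show ?thesis unfolding L_iff by (intro exI[of _ m] exI[of _ "-n"]) auto
  qed
  from this[of p] this[of "cnj p"] show ?thesis by auto
qed

lemma periods_in_L [simp]: "2 * of_real w \<in> L" "2 * (\<i> * of_real w') \<in> L"
  unfolding L_iff by (auto intro: exI[of _ 1] exI[of _ 0])

lemma half_not_in_L:
  assumes "Re z = w \<or> Im z = w'"
  shows "z \<notin> L"
proof
  assume "z \<in> L"
  then obtain m n where "Re z = 2 * w * of_int m" "Im z = 2 * w' * of_int n"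
    by (auto simp: L_iff)
  with assms w_pos w'_pos have "1 = 2 * real_of_int m \<or> 1 = 2 * real_of_int n"
    by auto
  then have "1 = 2 * m \<or> 1 = 2 * n" by linarith
  then show False by presburger
qed

text \<open>With \<open>M\<close> the larger absolute index, the geometric mean of
  \<open>1 + |m|\<close> and \<open>1 + |n|\<close> is at most \<open>1 + M\<close>, hence at most
  \<open>2 * M\<close>, and one coordinate of the lattice point has size at least
  \<open>min w w' * (2 * M)\<close>. The product form is chosen so that lattice sums are dominated
  by products of one-dimensional sums.\<close>

lemma norm_lpt_ge:
  assumes "p \<noteq> (0, 0)"
  shows "norm (lpt p) \<ge> min w w' * sqrt ((1 + \<bar>real_of_int (fst p)\<bar>) * (1 + \<bar>real_of_int (snd p)\<bar>))"
proof -
  obtain m n where p: "p = (m, n)" by force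
  define M where "M = max \<bar>real_of_int m\<bar> \<bar>real_of_int n\<bar>"
  have "M \<ge> 1"
    using assms unfolding p M_def by (cases "m = 0") auto
  have "sqrt ((1 + \<bar>real_of_int m\<bar>) * (1 + \<bar>real_of_int n\<bar>)) \<le> sqrt ((1 + M) * (1 + M))"
    by (intro real_sqrt_le_mono mult_mono) (auto simp: M_def)
  also have "\<dots> = 1 + M" using \<open>M \<ge> 1\<close> by simp
  also have "\<dots> \<le> 2 * M" using \<open>M \<ge> 1\<close> by simp
  finally have "min w w' * sqrt ((1 + \<bar>real_of_int m\<bar>) * (1 + \<bar>real_of_int n\<bar>)) \<le> min w w' * (2 * M)"
    using w_pos w'_pos by (intro mult_left_mono) auto
  also have "\<dots> \<le> norm (lpt p)"
  proof (cases "\<bar>real_of_int m\<bar> \<ge> \<bar>real_of_int n\<bar>")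
    case True
    then have "min w w' * (2 * M) \<le> w * (2 * \<bar>real_of_int m\<bar>)"
      using w_pos by (intro mult_mono) (auto simp: M_def)
    also have "\<dots> = \<bar>Re (lpt p)\<bar>" using w_pos by (simp add: p abs_mult)
    also have "\<dots> \<le> norm (lpt p)" by (rule abs_Re_le_cmod)
    finally show ?thesis .
  next
    case False
    then have "min w w' * (2 * M) \<le> w' * (2 * \<bar>real_of_int n\<bar>)"
      using w'_pos by (intro mult_mono) (auto simp: M_def)
    also have "\<dots> = \<bar>Im (lpt p)\<bar>" using w'_pos by (simp add: p abs_mult)
    also have "\<dots> \<le> norm (lpt p)" by (rule abs_Im_le_cmod)
    finally show ?thesis .
  qed
  finally show ?thesis by (simp add: p)
qed

lemma norm_L_ge:
  assumes "p \<in> L" "p \<noteq> 0"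
  shows "norm p \<ge> min w w'"
proof -
  obtain q where q: "p = lpt q" using assms by (auto simp: L_eq)
  have "q \<noteq> (0, 0)" using assms(2) by (auto simp: q lpt_def)
  have "min w w' * 1 \<le> min w w' * sqrt ((1 + \<bar>real_of_int (fst q)\<bar>) * (1 + \<bar>real_of_int (snd q)\<bar>))"
    using w_pos w'_pos mult_mono[of 1 "1 + \<bar>real_of_int (fst q)\<bar>" 1 "1 + \<bar>real_of_int (snd q)\<bar>"]
    by (intro mult_left_mono) auto
  with norm_lpt_ge[OF \<open>q \<noteq> (0, 0)\<close>] show ?thesis by (simp add: q)
qed

text \<open>Cubing the geometric-mean bound puts exponent 3/2 on each index separately, and 3/2 > 1
  makes both one-dimensional series converge.\<close>

lemma summable_norm_cube: "(\<lambda>p. 1 / norm p ^ 3) summable_on L - {0}"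
proof -
  define c where "c = min w w'"
  have "c > 0" using w_pos w'_pos by (simp add: c_def)
  define a where "a n = (1 + \<bar>real_of_int n\<bar>) powr (-3/2)" for n
  have "(\<lambda>(m, n). a m * a n) summable_on UNIV"
    unfolding a_def by (intro summable_on_product_nonneg summable_on_int_powr) auto
  then have "(\<lambda>q. (1 / c ^ 3) * (case q of (m, n) \<Rightarrow> a m * a n)) summable_on UNIV - {(0, 0)}"
    by (intro summable_on_cmult_right) (auto intro: summable_on_subset_banach)
  then have "(\<lambda>q. 1 / norm (lpt q) ^ 3) summable_on UNIV - {(0, 0)}"
  proof (rule summable_on_comparison_test)
    fix q :: "int \<times> int" assume "q \<in> UNIV - {(0, 0)}"
    then have q: "q \<noteq> (0, 0)" by auto
    define x y where "x = 1 + \<bar>real_of_int (fst q)\<bar>" and "y = 1 + \<bar>real_of_int (snd q)\<bar>"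
    have xy: "x > 0" "y > 0" by (auto simp: x_def y_def)
    have "c ^ 3 * (x powr (3/2) * y powr (3/2)) = (c * sqrt (x * y)) ^ 3"
      using xy by (simp add: power_mult_distrib powr_half_sqrt[symmetric] powr_powr powr_mult
          flip: powr_realpow)
    also have "\<dots> \<le> norm (lpt q) ^ 3"
      using norm_lpt_ge[OF q] \<open>c > 0\<close> xy unfolding c_def x_def y_def by (intro power_mono) auto
    finally have le: "c ^ 3 * (x powr (3/2) * y powr (3/2)) \<le> norm (lpt q) ^ 3" .
    have "1 / norm (lpt q) ^ 3 \<le> 1 / (c ^ 3 * (x powr (3/2) * y powr (3/2)))"
      by (rule frac_le) (use le \<open>c > 0\<close> xy in auto)
    also have "\<dots> = 1 / c ^ 3 * (case q of (m, n) \<Rightarrow> a m * a n)"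
      by (simp add: a_def x_def y_def case_prod_unfold powr_minus field_simps)
    finally show "1 / norm (lpt q) ^ 3 \<le> 1 / c ^ 3 * (case q of (m, n) \<Rightarrow> a m * a n)" .
  qed auto
  moreover have "L - {0} = lpt ` (UNIV - {(0, 0)})"
  proof -
    have "lpt q = 0 \<longleftrightarrow> q = (0, 0)" for q
      using inj_eq[OF inj_lpt, of q "(0, 0)"] by (simp add: lpt_def)
    then show ?thesis by (auto simp: L_eq)
  qed
  moreover have "inj_on lpt (UNIV - {(0, 0)})"
    using inj_lpt by (rule inj_on_subset) auto
  ultimately show ?thesis
    by (simp add: summable_on_reindex o_def)
qed

lemma summable_norm_powers:
  assumes "n \<ge> 3"
  shows "(\<lambda>p. 1 / norm p ^ n) summable_on L - {0}"
proof -
  define c where "c = min w w'"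
  have "c > 0" using w_pos w'_pos by (simp add: c_def)
  have "(\<lambda>p. 1 / c ^ (n - 3) * (1 / norm p ^ 3)) summable_on L - {0}"
    by (intro summable_on_cmult_right summable_norm_cube)
  then show ?thesis
  proof (rule summable_on_comparison_test)
    fix p assume p: "p \<in> L - {0}"
    have "c ^ (n - 3) * norm p ^ 3 \<le> norm p ^ (n - 3) * norm p ^ 3"
      using norm_L_ge[of p] p \<open>c > 0\<close> by (intro mult_right_mono power_mono) (auto simp: c_def)
    also have "\<dots> = norm p ^ n" using assms by (simp flip: power_add)
    finally show "1 / norm p ^ n \<le> 1 / c ^ (n - 3) * (1 / norm p ^ 3)"
      using \<open>c > 0\<close> p by (simp add: field_simps)
  qed auto
qed

lemma summable_powers: "n \<ge> 3 \<Longrightarrow> (\<lambda>p. 1 / p ^ n) summable_on L - {0}"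
  by (rule abs_summable_summable) (use summable_norm_powers[of n] in \<open>simp add: norm_divide norm_power\<close>)

text \<open>The substitution p -> -p maps the lattice to itself and changes the sign of every
  term.\<close>

lemma infsum_odd_powers:
  assumes "odd n"
  shows "infsum (\<lambda>p. 1 / p ^ n) (L - {0}) = 0"
proof -
  have "infsum (\<lambda>p. 1 / p ^ n) (L - {0}) = infsum (\<lambda>p. - (1 / p ^ n)) (L - {0})"
    by (rule infsum_reindex_bij_witness[of _ uminus uminus]) (use assms in auto)
  then show ?thesis by (simp add: infsum_uminus)
qed

section \<open>Discreteness of the lattice and holomorphy of lattice sums\<close>

lemma closed_L: "closed L"
proof (rule discrete_imp_closed[of "min w w'"])
  show "\<forall>x\<in>L. \<forall>y\<in>L. dist y x < min w w' \<longrightarrow> y = x"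
    using norm_L_ge diff_in_L by (force simp: dist_norm)
qed (use w_pos w'_pos in auto)

lemma closed_L': "closed (L - {0})"
proof (rule discrete_imp_closed[of "min w w'"])
  show "\<forall>x\<in>L - {0}. \<forall>y\<in>L - {0}. dist y x < min w w' \<longrightarrow> y = x"
    using norm_L_ge diff_in_L by (force simp: dist_norm)
qed (use w_pos w'_pos in auto)

text \<open>Lattice points far from the origin satisfy the bound with factor 1/2 by the triangle
  inequality; the near ones are kept away by a disc around \<open>z0\<close> that contains no
  nonzero lattice point.\<close>

lemma norm_diff_L_lower_bound:
  assumes "z0 \<notin> L - {0}"
  obtains \<epsilon> \<delta> where "\<epsilon> > 0" "\<delta> > 0"
    "\<And>z p. z \<in> cball z0 \<epsilon> \<Longrightarrow> p \<in> L - {0} \<Longrightarrow> norm (z - p) \<ge> \<delta> * norm p"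
proof -
  have "open (- (L - {0}))" using closed_L' open_Compl by blast
  then obtain e where e: "e > 0" "cball z0 e \<subseteq> - (L - {0})"
    using assms by (meson Compl_iff open_contains_cball_eq)
  define R where "R = norm z0 + e + 1"
  \<comment> \<open>The factor \<open>e / (4 * R)\<close> makes \<open>\<delta> * norm p\<close> at
    most \<open>e / 2\<close> whenever \<open>norm p < 2 * R\<close>; the distance from
    \<open>z\<close> to \<open>p\<close> exceeds this because \<open>z\<close> stays in the disc of
    half the radius.\<close>
  define \<delta> where "\<delta> = min (1/2) (e / (4 * R))"
  have R: "R > 0" using e(1) by (simp add: R_def add_nonneg_pos)
  show thesis
  proof (rule that[of "e / 2" \<delta>])
    fix z p assume z: "z \<in> cball z0 (e/2)" and p: "p \<in> L - {0}"
    have nz: "norm z \<le> R"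
    proof -
      have "norm z \<le> norm z0 + norm (z - z0)" by (metis add.commute diff_add_cancel norm_triangle_ineq)
      with z e(1) show ?thesis by (simp add: R_def dist_norm norm_minus_commute)
    qed
    show "\<delta> * norm p \<le> norm (z - p)"
    proof (cases "norm p \<ge> 2 * R")
      case True
      have "\<delta> * norm p \<le> 1/2 * norm p" by (intro mult_right_mono) (auto simp: \<delta>_def)
      also have "\<dots> \<le> norm p - norm z" using True nz by simp
      also have "\<dots> \<le> norm (z - p)" by (metis norm_minus_commute norm_triangle_ineq2)
      finally show ?thesis .
    next
      case False
      have "p \<notin> cball z0 e" using p e(2) by blast
      then have far: "e < norm (z0 - p)" by (simp add: dist_norm)
      have "norm (z0 - p) \<le> norm (z0 - z) + norm (z - p)"
        by (metis diff_add_cancel diff_add_eq norm_triangle_ineq add_diff_eq)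
      then have "e / 2 \<le> norm (z - p)" using far z by (simp add: dist_norm)
      have "\<delta> * norm p \<le> (e / (4 * R)) * (2 * R)"
        by (intro mult_mono) (use False R e(1) in \<open>auto simp: \<delta>_def\<close>)
      also have "\<dots> = e / 2" using R by simp
      finally show ?thesis using \<open>e / 2 \<le> norm (z - p)\<close> by simp
    qed
  qed (use e(1) R in \<open>auto simp: \<delta>_def\<close>)
qed

text \<open>The cubic majorant allows the Weierstrass M-test on a closed disc around each point, and
  a uniform limit of holomorphic partial sums is holomorphic. The domain contains 0, so the result
  also yields Taylor behaviour at the origin.\<close>

lemma holomorphic_infsum_L:
  fixes f :: "complex \<Rightarrow> complex \<Rightarrow> complex"
  assumes holo: "\<And>p. p \<in> L - {0} \<Longrightarrow> f p holomorphic_on - (L - {0})"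
    and bound: "\<And>R \<delta>. R > 0 \<Longrightarrow> \<delta> > 0 \<Longrightarrow> \<exists>C. \<forall>z p. norm z \<le> R \<longrightarrow> p \<in> L - {0} \<longrightarrow>
      norm (z - p) \<ge> \<delta> * norm p \<longrightarrow> norm (f p z) \<le> C * (1 / norm p ^ 3)"
  shows "(\<lambda>z. infsum (\<lambda>p. f p z) (L - {0})) holomorphic_on - (L - {0})"
    and "z \<notin> L - {0} \<Longrightarrow> (\<lambda>p. f p z) summable_on L - {0}"
proof -
  have *: "\<exists>\<epsilon>>0. (\<lambda>z. infsum (\<lambda>p. f p z) (L - {0})) holomorphic_on ball z0 \<epsilon> \<and>
        (\<lambda>p. f p z0) summable_on L - {0}" if z0: "z0 \<notin> L - {0}" for z0
  proof -
    obtain \<epsilon> \<delta> where ed: "\<epsilon> > 0" "\<delta> > 0"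
      "\<And>z p. z \<in> cball z0 \<epsilon> \<Longrightarrow> p \<in> L - {0} \<Longrightarrow> norm (z - p) \<ge> \<delta> * norm p"
      using norm_diff_L_lower_bound[OF z0] by blast
    define R where "R = norm z0 + \<epsilon>"
    have "R > 0" using ed by (simp add: R_def add_nonneg_pos)
    have nz: "norm z \<le> R" if "z \<in> cball z0 \<epsilon>" for z
    proof -
      have "norm z \<le> norm z0 + norm (z - z0)" by (metis add.commute diff_add_cancel norm_triangle_ineq)
      with that show ?thesis by (simp add: R_def dist_norm norm_minus_commute)
    qed
    obtain C where C: "\<And>z p. norm z \<le> R \<Longrightarrow> p \<in> L - {0} \<Longrightarrow>
        norm (z - p) \<ge> \<delta> * norm p \<Longrightarrow> norm (f p z) \<le> C * (1 / norm p ^ 3)"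
      using bound[OF \<open>R > 0\<close> ed(2)] by blast
    have le: "norm (f p z) \<le> C * (1 / norm p ^ 3)" if "p \<in> L - {0}" "z \<in> cball z0 \<epsilon>" for p z
      using C nz ed(3) that by blast
    have sm: "(\<lambda>p. C * (1 / norm p ^ 3)) summable_on L - {0}"
      by (intro summable_on_cmult_right summable_norm_cube)
    have ul: "uniform_limit (cball z0 \<epsilon>) (\<lambda>X z. \<Sum>p\<in>X. f p z)
        (\<lambda>z. infsum (\<lambda>p. f p z) (L - {0})) (finite_subsets_at_top (L - {0}))"
      by (rule Weierstrass_m_test_general[OF le sm])
    have sub: "cball z0 \<epsilon> \<subseteq> - (L - {0})"
    proof
      fix z assume z: "z \<in> cball z0 \<epsilon>"
      show "z \<in> - (L - {0})"
      proof
        assume "z \<in> L - {0}"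
        with ed(3)[OF z this] ed(2) show False by (auto simp: mult_le_0_iff)
      qed
    qed
    have hol: "(\<lambda>z. \<Sum>p\<in>X. f p z) holomorphic_on cball z0 \<epsilon>" if "X \<subseteq> L - {0}" for X
      using that by (intro holomorphic_on_sum holomorphic_on_subset[OF holo sub]) auto
    have "\<forall>\<^sub>F X in finite_subsets_at_top (L - {0}).
       continuous_on (cball z0 \<epsilon>) (\<lambda>z. \<Sum>p\<in>X. f p z) \<and> (\<lambda>z. \<Sum>p\<in>X. f p z) holomorphic_on ball z0 \<epsilon>"
      by (rule eventually_finite_subsets_at_top_weakI)
        (auto intro: holomorphic_on_imp_continuous_on hol holomorphic_on_subset[OF hol ball_subset_cball])
    from holomorphic_uniform_limit[OF this ul]
    have "(\<lambda>z. infsum (\<lambda>p. f p z) (L - {0})) holomorphic_on ball z0 \<epsilon>" by auto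
    moreover have "(\<lambda>p. f p z0) summable_on L - {0}"
      by (rule abs_summable_summable, rule Infinite_Sum.abs_summable_on_comparison_test'[OF sm]) (use le ed in auto)
    ultimately show ?thesis using ed(1) by blast
  qed
  show "z \<notin> L - {0} \<Longrightarrow> (\<lambda>p. f p z) summable_on L - {0}" using * by blast
  show "(\<lambda>z. infsum (\<lambda>p. f p z) (L - {0})) holomorphic_on - (L - {0})"
    using * closed_L'
    by (intro analytic_imp_holomorphic) (auto simp: analytic_on_def)
qed

subsection \<open>The Weierstrass function\<close>

text \<open>The Weierstrass function. Since \<open>1 / 0 = 0\<close>, the summand for \<open>p = 0\<close> is \<open>1 / z\<^sup>2\<close>.\<close>
definition wp :: "complex \<Rightarrow> complex" where
  "wp z = infsum (\<lambda>p. 1 / (z - p)\<^sup>2 - 1 / p\<^sup>2) L"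

text \<open>The part of \<open>wp\<close> that stays holomorphic at the origin: the double pole
  \<open>1 / z ^ 2\<close> is left out.\<close>

definition wp_reg :: "complex \<Rightarrow> complex" where
  "wp_reg z = infsum (\<lambda>p. 1 / (z - p)\<^sup>2 - 1 / p\<^sup>2) (L - {0})"

text \<open>The remainder after subtracting the Taylor polynomial of \<open>1 / (z - p)\<^sup>2\<close> of degree 4 and
  dividing by \<open>z ^ 5\<close>.\<close>
definition wp_rem :: "complex \<Rightarrow> complex" where
  "wp_rem z = infsum (\<lambda>p. (6 * p - 5 * z) / (p ^ 6 * (z - p)\<^sup>2)) (L - {0})"

text \<open>Over a common denominator the leading terms cancel and the numerator
  \<open>z * (2 * p - z)\<close> is only linear in \<open>p\<close>, so the term decays like the
  inverse cube. The ratio \<open>R / c\<close> absorbs \<open>norm z\<close> into a multiple of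
  \<open>norm p\<close>.\<close>

lemma wp_term_bound:
  assumes "R > 0" "\<delta> > 0"
  shows "\<exists>C. \<forall>z p. norm z \<le> R \<longrightarrow> p \<in> L - {0} \<longrightarrow> norm (z - p) \<ge> \<delta> * norm p \<longrightarrow>
    norm (1 / (z - p)\<^sup>2 - 1 / p\<^sup>2) \<le> C * (1 / norm p ^ 3)"
proof -
  define c where "c = min w w'"
  have "c > 0" using w_pos w'_pos by (simp add: c_def)
  have "norm (1 / (z - p)\<^sup>2 - 1 / p\<^sup>2) \<le> (R * (2 + R / c) / \<delta>\<^sup>2) * (1 / norm p ^ 3)"
    if z: "norm z \<le> R" and p: "p \<in> L - {0}" and le: "norm (z - p) \<ge> \<delta> * norm p" for z p
  proof -
    have np: "norm p \<ge> c" "norm p > 0" using norm_L_ge p by (auto simp: c_def)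
    have "z \<noteq> p" using le np \<open>\<delta> > 0\<close> by (auto simp: mult_le_0_iff)
    then have eq: "1 / (z - p)\<^sup>2 - 1 / p\<^sup>2 = z * (2 * p - z) / (p\<^sup>2 * (z - p)\<^sup>2)"
      using p by (simp add: divide_simps) (simp add: power2_eq_square algebra_simps)
    have "norm (2 * p - z) \<le> 2 * norm p + norm z"
      using norm_triangle_ineq4[of "2 * p" z] by (simp add: norm_mult)
    also have "\<dots> \<le> 2 * norm p + R / c * norm p"
      using mult_mono[OF z np(1)] z np \<open>c > 0\<close> \<open>R > 0\<close> by (simp add: field_simps mult_left_mono)
    finally have num: "norm (2 * p - z) \<le> (2 + R / c) * norm p" by (simp add: algebra_simps)
    have "norm (1 / (z - p)\<^sup>2 - 1 / p\<^sup>2) = norm z * norm (2 * p - z) / ((norm p)\<^sup>2 * (norm (z - p))\<^sup>2)"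
      unfolding eq by (simp add: norm_divide norm_mult norm_power)
    also have "\<dots> \<le> R * ((2 + R / c) * norm p) / ((norm p)\<^sup>2 * (\<delta> * norm p)\<^sup>2)"
      using np \<open>\<delta> > 0\<close> \<open>R > 0\<close> \<open>c > 0\<close> z
      by (intro frac_le mult_mono mult_pos_pos num power_mono le) auto
    also have "\<dots> = (R * (2 + R / c) / \<delta>\<^sup>2) * (1 / norm p ^ 3)"
      using np by (simp add: power2_eq_square power3_eq_cube)
    finally show ?thesis .
  qed
  then show ?thesis by blast
qed

text \<open>The term decays like the inverse seventh power of \<open>norm p\<close>; four of these
  factors are bounded below by \<open>c\<close>, which leaves the inverse cube that the general
  convergence result expects.\<close>

lemma wp_rem_term_bound:
  assumes "R > 0" "\<delta> > 0"
  shows "\<exists>C. \<forall>z p. norm z \<le> R \<longrightarrow> p \<in> L - {0} \<longrightarrow> norm (z - p) \<ge> \<delta> * norm p \<longrightarrow>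
    norm ((6 * p - 5 * z) / (p ^ 6 * (z - p)\<^sup>2)) \<le> C * (1 / norm p ^ 3)"
proof -
  define c where "c = min w w'"
  have "c > 0" using w_pos w'_pos by (simp add: c_def)
  have "norm ((6 * p - 5 * z) / (p ^ 6 * (z - p)\<^sup>2)) \<le> ((6 + 5 * R / c) / (c ^ 4 * \<delta>\<^sup>2)) * (1 / norm p ^ 3)"
    if z: "norm z \<le> R" and p: "p \<in> L - {0}" and le: "norm (z - p) \<ge> \<delta> * norm p" for z p
  proof -
    have np: "norm p \<ge> c" "norm p > 0" using norm_L_ge p by (auto simp: c_def)
    have "norm (6 * p - 5 * z) \<le> 6 * norm p + 5 * norm z"
      using norm_triangle_ineq4[of "6 * p" "5 * z"] by (simp add: norm_mult)
    also have "\<dots> \<le> 6 * norm p + 5 * R / c * norm p"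
      using mult_mono[OF z np(1)] z np \<open>c > 0\<close> \<open>R > 0\<close> by (simp add: field_simps mult_left_mono)
    finally have num: "norm (6 * p - 5 * z) \<le> (6 + 5 * R / c) * norm p" by (simp add: algebra_simps)
    have "norm ((6 * p - 5 * z) / (p ^ 6 * (z - p)\<^sup>2)) = norm (6 * p - 5 * z) / (norm p ^ 4 * norm p ^ 2 * (norm (z - p))\<^sup>2)"
      by (simp add: norm_divide norm_mult norm_power flip: power_add)
    also have "\<dots> \<le> ((6 + 5 * R / c) * norm p) / (c ^ 4 * norm p ^ 2 * (\<delta> * norm p)\<^sup>2)"
      using np \<open>\<delta> > 0\<close> \<open>R > 0\<close> \<open>c > 0\<close> z
      by (intro frac_le mult_mono mult_pos_pos num power_mono le) auto
    also have "\<dots> = ((6 + 5 * R / c) / (c ^ 4 * \<delta>\<^sup>2)) * (1 / norm p ^ 3)"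
      using np by (simp add: power2_eq_square power3_eq_cube)
    finally show ?thesis .
  qed
  then show ?thesis by blast
qed

lemma holomorphic_wp_term:
  "p \<in> L - {0} \<Longrightarrow> (\<lambda>z. 1 / (z - p)\<^sup>2 - 1 / p\<^sup>2) holomorphic_on - (L - {0})"
  by (auto intro!: holomorphic_intros)

lemmas holomorphic_wp_reg =
  holomorphic_infsum_L(1)[OF holomorphic_wp_term wp_term_bound, folded wp_reg_def]

lemma summable_wp_reg:
  assumes "z \<notin> L - {0}"
  shows "(\<lambda>p. 1 / (z - p)\<^sup>2 - 1 / p\<^sup>2) summable_on L - {0}"
  by (rule holomorphic_infsum_L(2)[OF holomorphic_wp_term wp_term_bound]) (use assms in auto)

lemma holomorphic_wp_rem_term:
  "p \<in> L - {0} \<Longrightarrow> (\<lambda>z. (6 * p - 5 * z) / (p ^ 6 * (z - p)\<^sup>2)) holomorphic_on - (L - {0})"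
  by (auto intro!: holomorphic_intros)

lemmas holomorphic_wp_rem =
  holomorphic_infsum_L(1)[OF holomorphic_wp_rem_term wp_rem_term_bound, folded wp_rem_def]

lemma summable_wp_rem:
  assumes "z \<notin> L - {0}"
  shows "(\<lambda>p. (6 * p - 5 * z) / (p ^ 6 * (z - p)\<^sup>2)) summable_on L - {0}"
  by (rule holomorphic_infsum_L(2)[OF holomorphic_wp_rem_term wp_rem_term_bound]) (use assms in auto)

lemma summable_wp:
  assumes "z \<notin> L - {0}"
  shows "(\<lambda>p. 1 / (z - p)\<^sup>2 - 1 / p\<^sup>2) summable_on L"
  using summable_on_insert_iff[of "\<lambda>p. 1 / (z - p)\<^sup>2 - 1 / p\<^sup>2" 0 "L - {0}"] summable_wp_reg[OF assms]
  by (simp add: insert_absorb)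

lemma wp_conv_reg:
  assumes "z \<notin> L - {0}"
  shows "wp z = 1 / z\<^sup>2 + wp_reg z"
  using infsum_insert[of "\<lambda>p. 1 / (z - p)\<^sup>2 - 1 / p\<^sup>2" "L - {0}" 0] summable_wp_reg[OF assms]
  by (simp add: insert_absorb wp_def wp_reg_def)

section \<open>Symmetries and periodicity of the Weierstrass function\<close>

lemma wp_minus: "wp (- z) = wp z"
  unfolding wp_def
  by (rule infsum_reindex_bij_witness[of _ uminus uminus]) (auto simp: power2_eq_square algebra_simps)

lemma wp_cnj: "wp (cnj z) = cnj (wp z)"
  unfolding wp_def infsum_cnj[symmetric]
  by (rule infsum_reindex_bij_witness[of _ cnj cnj]) auto

text \<open>Shifting the summation index by \<open>p\<close> aligns the series of
  \<open>wp (z + p)\<close> with that of \<open>wp z\<close>. In the difference the fractions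
  containing \<open>z\<close> cancel, leaving a series in \<open>q\<close> and \<open>p\<close>
  alone.\<close>

lemma wp_periodic_aux:
  assumes p: "p \<in> L" and z: "z \<notin> L" "z' \<notin> L"
  shows "wp (z + p) - wp z = wp (z' + p) - wp z'"
proof -
  have *: "wp (z + p) - wp z = infsum (\<lambda>q. 1 / q\<^sup>2 - 1 / (q + p)\<^sup>2) L" if "z \<notin> L" for z
  proof -
    have zp: "z + p \<notin> L" using p that by (simp add: add_in_L_iff)
    have "wp (z + p) = infsum (\<lambda>q. 1 / (z - q)\<^sup>2 - 1 / (q + p)\<^sup>2) L"
      unfolding wp_def
      by (rule infsum_reindex_bij_witness[of _ "\<lambda>q. q + p" "\<lambda>q. q - p"])
        (auto simp: add_in_L diff_in_L p algebra_simps)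
    moreover have "(\<lambda>q. 1 / (z - q)\<^sup>2 - 1 / (q + p)\<^sup>2) summable_on L \<longleftrightarrow>
        (\<lambda>q. 1 / (z + p - q)\<^sup>2 - 1 / q\<^sup>2) summable_on L"
      by (rule summable_on_reindex_bij_witness[of _ "\<lambda>q. q - p" "\<lambda>q. q + p"])
        (auto simp: add_in_L diff_in_L p algebra_simps)
    ultimately have "((\<lambda>q. 1 / (z - q)\<^sup>2 - 1 / (q + p)\<^sup>2) has_sum wp (z + p)) L"
      using summable_wp[of "z + p"] zp by (simp add: has_sum_infsum)
    moreover have "((\<lambda>q. 1 / (z - q)\<^sup>2 - 1 / q\<^sup>2) has_sum wp z) L"
      unfolding wp_def using summable_wp[of z] that by (simp add: has_sum_infsum)
    ultimately have "((\<lambda>q. (1 / (z - q)\<^sup>2 - 1 / (q + p)\<^sup>2) + (-1) * (1 / (z - q)\<^sup>2 - 1 / q\<^sup>2)) has_sum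
        (wp (z + p) + (-1) * wp z)) L"
      by (intro has_sum_add has_sum_cmult_right)
    then show ?thesis by (simp add: infsumI)
  qed
  show ?thesis using *[OF z(1)] *[OF z(2)] by simp
qed

text \<open>The difference does not depend on \<open>z\<close>; at \<open>z = - p / 2\<close> it vanishes because \<open>wp\<close> is even.\<close>
lemma wp_periodic_gen:
  assumes p: "p \<in> L" "p / 2 \<notin> L" and z: "z \<notin> L"
  shows "wp (z + p) = wp z"
  using wp_periodic_aux[OF p(1) z, of "- (p / 2)"] wp_minus[of "p / 2"] p(2)
  by simp

text \<open>Evaluating at \<open>- p / 2\<close> is impossible when \<open>p / 2\<close> is itself a
  lattice point. In that case \<open>p\<close> is split as \<open>(p - q) + q\<close>, where neither
  summand has its half in the lattice.\<close>

lemma wp_periodic: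
  assumes p: "p \<in> L" and z: "z \<notin> L"
  shows "wp (z + p) = wp z"
proof (cases "p / 2 \<in> L")
  case False
  then show ?thesis using wp_periodic_gen p z by blast
next
  case True
  define q where "q = 2 * complex_of_real w"
  have q: "q \<in> L" "q / 2 \<notin> L" by (auto simp: q_def half_not_in_L)
  have pq: "p - q \<in> L" "(p - q) / 2 \<notin> L"
    using p q True diff_in_L[of "p/2" "(p - q)/2"] by (auto simp: diff_in_L field_simps)
  have "wp (z + (p - q) + q) = wp (z + (p - q))"
    using q z pq by (intro wp_periodic_gen) (auto simp: add_in_L_iff)
  also have "\<dots> = wp z" by (intro wp_periodic_gen pq z)
  finally show ?thesis by simp
qed

lemma holomorphic_wp: "wp holomorphic_on - L"
proof -
  have "(\<lambda>z. 1 / z\<^sup>2 + wp_reg z) holomorphic_on - L"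
    by (auto intro!: holomorphic_intros holomorphic_on_subset[OF holomorphic_wp_reg])
  then show ?thesis
    by (rule holomorphic_transform) (simp add: wp_conv_reg)
qed

lemma wp_near_lattice:
  assumes "p \<in> L" "z - p \<notin> L"
  shows "wp z = 1 / (z - p)\<^sup>2 + wp_reg (z - p)"
  using wp_periodic[OF assms] wp_conv_reg[of "z - p"] assms by simp

lemma eventually_not_in_L: "eventually (\<lambda>z. z \<notin> L) (at z0)"
proof -
  have "open (- (L - {z0}))"
  proof -
    have "closed (L - {z0})"
      by (rule discrete_imp_closed[of "min w w'"])
        (use norm_L_ge diff_in_L w_pos w'_pos in \<open>force simp: dist_norm\<close>)+
    then show ?thesis by blast
  qed
  from eventually_at_in_open[OF this, of z0] show ?thesis
    by (auto elim!: eventually_mono)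
qed

section \<open>Eisenstein sums and the expansion at the origin\<close>

abbreviation "G4 \<equiv> infsum (\<lambda>p. 1 / p ^ 4) (L - {0})"
abbreviation "G6 \<equiv> infsum (\<lambda>p. 1 / p ^ 6) (L - {0})"

text \<open>Each summand is expanded in \<open>z / p\<close> with an exact remainder and the
  coefficients are summed separately; the odd Eisenstein sums vanish, which removes the terms in
  \<open>z\<close> and \<open>z ^ 3\<close>.\<close>

lemma wp_reg_expansion:
  assumes "z \<notin> L - {0}"
  shows "wp_reg z = 3 * G4 * z\<^sup>2 + 5 * G6 * z ^ 4 + z ^ 5 * wp_rem z"
proof -
  have hs: "((\<lambda>p. 1 / p ^ n) has_sum infsum (\<lambda>p. 1 / p ^ n) (L - {0})) (L - {0})" if "n \<ge> 3" for n
    using summable_powers[OF that] by (rule has_sum_infsum)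
  have "((\<lambda>p. (2 * z) * (1 / p ^ 3) + (3 * z\<^sup>2) * (1 / p ^ 4) + (4 * z ^ 3) * (1 / p ^ 5)
        + (5 * z ^ 4) * (1 / p ^ 6) + z ^ 5 * ((6 * p - 5 * z) / (p ^ 6 * (z - p)\<^sup>2))) has_sum
      ((2 * z) * infsum (\<lambda>p. 1 / p ^ 3) (L - {0}) + (3 * z\<^sup>2) * G4
        + (4 * z ^ 3) * infsum (\<lambda>p. 1 / p ^ 5) (L - {0}) + (5 * z ^ 4) * G6 + z ^ 5 * wp_rem z)) (L - {0})"
    unfolding wp_rem_def using assms
    by (intro has_sum_add has_sum_cmult_right hs has_sum_infsum summable_wp_rem) auto
  also have "?this \<longleftrightarrow> ((\<lambda>p. 1 / (z - p)\<^sup>2 - 1 / p\<^sup>2) has_sum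
      ((2 * z) * infsum (\<lambda>p. 1 / p ^ 3) (L - {0}) + (3 * z\<^sup>2) * G4
        + (4 * z ^ 3) * infsum (\<lambda>p. 1 / p ^ 5) (L - {0}) + (5 * z ^ 4) * G6 + z ^ 5 * wp_rem z)) (L - {0})"
  proof (rule has_sum_cong)
    fix p assume p: "p \<in> L - {0}"
    then have "z \<noteq> p" "p \<noteq> 0" using assms by auto
    have [simp]: "(z - p)\<^sup>2 \<noteq> 0" using \<open>z \<noteq> p\<close> by simp
    \<comment> \<open>Multiplication by \<open>p ^ 6 * (z - p) ^ 2\<close> clears all denominators,
      so the termwise identity becomes one between polynomials.\<close>
    have "p ^ 6 * (z - p)\<^sup>2 * ((2 * z) * (1 / p ^ 3) + (3 * z\<^sup>2) * (1 / p ^ 4) + (4 * z ^ 3) * (1 / p ^ 5)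
        + (5 * z ^ 4) * (1 / p ^ 6) + z ^ 5 * ((6 * p - 5 * z) / (p ^ 6 * (z - p)\<^sup>2)))
      = (z - p)\<^sup>2 * (2 * z * p ^ 3 + 3 * z\<^sup>2 * p\<^sup>2 + 4 * z ^ 3 * p + 5 * z ^ 4) + z ^ 5 * (6 * p - 5 * z)"
      using \<open>p \<noteq> 0\<close> \<open>z \<noteq> p\<close> by (simp add: distrib_left power_numeral_reduce)
    also have "\<dots> = p ^ 4 * (p\<^sup>2 - (z - p)\<^sup>2)"
      by algebra
    also have "\<dots> = p ^ 6 * (z - p)\<^sup>2 * (1 / (z - p)\<^sup>2 - 1 / p\<^sup>2)"
    proof -
      have "p ^ 6 / p\<^sup>2 = p ^ 4" using \<open>p \<noteq> 0\<close> by (simp add: power_numeral_reduce)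
      then have "(z - p)\<^sup>2 * (p ^ 6 / p\<^sup>2) = (z - p)\<^sup>2 * p ^ 4" by simp
      then show ?thesis using \<open>p \<noteq> 0\<close> \<open>z \<noteq> p\<close>
        by (simp add: right_diff_distrib power_add[of p 4 2, simplified] mult_ac)
    qed
    finally show "(2 * z) * (1 / p ^ 3) + (3 * z\<^sup>2) * (1 / p ^ 4) + (4 * z ^ 3) * (1 / p ^ 5)
        + (5 * z ^ 4) * (1 / p ^ 6) + z ^ 5 * ((6 * p - 5 * z) / (p ^ 6 * (z - p)\<^sup>2)) = 1 / (z - p)\<^sup>2 - 1 / p\<^sup>2"
      using \<open>p \<noteq> 0\<close> \<open>z \<noteq> p\<close> by (subst (asm) mult_left_cancel) auto
  qed
  finally show ?thesis
    unfolding wp_reg_def by (simp add: infsumI infsum_odd_powers)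
qed

subsection \<open>The differential equations of the Weierstrass function\<close>

lemma in_fundamental_rectangle:
  obtains p where "p \<in> L" "z - p \<in> cbox (- Complex w w') (Complex w w')"
proof -
  define m where "m = round (Re z / (2 * w))"
  define n where "n = round (Im z / (2 * w'))"
  have "\<bar>Re z - 2 * w * of_int m\<bar> \<le> w"
  proof -
    have "\<bar>of_int m - Re z / (2 * w)\<bar> * (2 * w) \<le> 1 / 2 * (2 * w)"
      unfolding m_def using w_pos by (intro mult_right_mono of_int_round_abs_le) auto
    also have "\<bar>of_int m - Re z / (2 * w)\<bar> * (2 * w) = \<bar>(of_int m - Re z / (2 * w)) * (2 * w)\<bar>"
      using w_pos by (simp add: abs_mult)
    also have "(of_int m - Re z / (2 * w)) * (2 * w) = 2 * w * of_int m - Re z"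
      using w_pos by (simp add: field_simps)
    finally show ?thesis by (simp add: abs_minus_commute)
  qed
  moreover have "\<bar>Im z - 2 * w' * of_int n\<bar> \<le> w'"
  proof -
    have "\<bar>of_int n - Im z / (2 * w')\<bar> * (2 * w') \<le> 1 / 2 * (2 * w')"
      unfolding n_def using w'_pos by (intro mult_right_mono of_int_round_abs_le) auto
    also have "\<bar>of_int n - Im z / (2 * w')\<bar> * (2 * w') = \<bar>(of_int n - Im z / (2 * w')) * (2 * w')\<bar>"
      using w'_pos by (simp add: abs_mult)
    also have "(of_int n - Im z / (2 * w')) * (2 * w') = 2 * w' * of_int n - Im z"
      using w'_pos by (simp add: field_simps)
    finally show ?thesis by (simp add: abs_minus_commute)
  qed
  ultimately show thesis
    by (intro that[of "lpt (m, n)"]) (auto simp: L_eq in_cbox_complex_iff)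
qed

text \<open>The limit 0 removes the singularity at the origin, and periodicity carries this to every
  lattice point. The extension is entire and takes all its values on one compact rectangle, so it is
  constant, and its value at the origin is 0.\<close>

lemma liouville_lattice:
  assumes holo: "f holomorphic_on - L"
    and per: "\<And>z p. z \<notin> L \<Longrightarrow> p \<in> L \<Longrightarrow> f (z + p) = f z"
    and lim: "f \<midarrow>0\<rightarrow> 0" and z: "z \<notin> L"
  shows "f z = 0"
proof -
  define g where "g z = (if z \<in> L then 0 else f z)" for z
  have g_per: "g (z + p) = g z" if "p \<in> L" for z p
    using per that by (auto simp: g_def add_in_L_iff)
  have op: "open (- (L - {0}))" using closed_L' by blast
  have "(\<lambda>y. if y = 0 then 0 else f y) holomorphic_on - (L - {0})"
    by (rule removable_singularity)
      (use op lim in \<open>auto intro: holomorphic_on_subset[OF holo]\<close>)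
  then have g0: "g holomorphic_on - (L - {0})"
    by (rule holomorphic_transform) (auto simp: g_def)
  have "g field_differentiable at z" for z
  proof (cases "z \<in> L")
    case False
    then show ?thesis
      using g0 op by (auto intro!: holomorphic_on_imp_differentiable_at)
  next
    case True
    have "g field_differentiable at 0"
      by (rule holomorphic_on_imp_differentiable_at[OF g0 op]) auto
    then have "(g \<circ> (\<lambda>x. x - z)) field_differentiable at z"
      by (intro field_differentiable_compose) (auto intro!: derivative_intros)
    moreover have "g \<circ> (\<lambda>x. x - z) = g"
      using g_per[OF True, of "x - z" for x] by (simp add: o_def fun_eq_iff)
    ultimately show ?thesis by simp
  qed
  then have hol: "g holomorphic_on UNIV"
    by (simp add: holomorphic_on_def field_differentiable_at_within)
  have "bounded (g ` cbox (- Complex w w') (Complex w w'))"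
    by (intro compact_imp_bounded compact_continuous_image holomorphic_on_imp_continuous_on
        holomorphic_on_subset[OF hol]) auto
  moreover have "range g = g ` cbox (- Complex w w') (Complex w w')"
  proof (intro equalityI subsetI)
    fix y assume "y \<in> range g"
    then obtain x where x: "y = g x" by blast
    obtain p where "p \<in> L" "x - p \<in> cbox (- Complex w w') (Complex w w')"
      by (rule in_fundamental_rectangle)
    then show "y \<in> g ` cbox (- Complex w w') (Complex w w')"
      using g_per[of p "x - p"] by (auto simp: x intro!: image_eqI[of _ _ "x - p"])
  qed auto
  ultimately have "g constant_on UNIV"
    using Liouville_theorem[OF hol] by simp
  then have "g z = g 0" by (metis constant_on_def UNIV_I)
  then show ?thesis using z by (simp add: g_def)
qed

lemma open_compl_L: "open (- L)"
  using closed_L by blast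

lemma open_compl_L': "open (- (L - {0}))"
  using closed_L' by blast

lemma deriv_periodic:
  assumes holo: "f holomorphic_on - L"
    and per: "\<And>z p. z \<notin> L \<Longrightarrow> p \<in> L \<Longrightarrow> f (z + p) = f z"
    and z: "z \<notin> L" and p: "p \<in> L"
  shows "deriv f (z + p) = deriv f z"
proof -
  have "z + p \<notin> L" using z p by (simp add: add_in_L_iff)
  then have "(f has_field_derivative deriv f (z + p)) (at (z + p))"
    using holomorphic_derivI[OF holo open_compl_L] by simp
  then have "((\<lambda>z. f (z + p)) has_field_derivative deriv f (z + p)) (at z)"
    by (simp add: DERIV_shift)
  then have "(f has_field_derivative deriv f (z + p)) (at z)"
    by (rule has_field_derivative_transform_within_open[OF _ open_compl_L]) (use z p per in auto)
  then show ?thesis by (simp add: DERIV_imp_deriv)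
qed

abbreviation "wp' \<equiv> deriv wp"
abbreviation "wp'' \<equiv> deriv wp'"

lemma holomorphic_wp': "wp' holomorphic_on - L"
  by (intro holomorphic_deriv holomorphic_wp open_compl_L)

lemma holomorphic_wp'': "wp'' holomorphic_on - L"
  by (intro holomorphic_deriv holomorphic_wp' open_compl_L)

lemma has_field_derivative_wp [derivative_intros]:
  assumes "(g has_field_derivative g') (at z within A)" "g z \<notin> L"
  shows "((\<lambda>z. wp (g z)) has_field_derivative wp' (g z) * g') (at z within A)"
  using DERIV_chain2[OF holomorphic_derivI[OF holomorphic_wp open_compl_L] assms(1)] assms(2) by simp

lemma has_field_derivative_wp' [derivative_intros]:
  assumes "(g has_field_derivative g') (at z within A)" "g z \<notin> L"
  shows "((\<lambda>z. wp' (g z)) has_field_derivative wp'' (g z) * g') (at z within A)"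
  using DERIV_chain2[OF holomorphic_derivI[OF holomorphic_wp' open_compl_L] assms(1)] assms(2) by simp

lemma wp'_periodic: "p \<in> L \<Longrightarrow> z \<notin> L \<Longrightarrow> wp' (z + p) = wp' z"
  by (intro deriv_periodic holomorphic_wp wp_periodic)

lemma wp''_periodic: "p \<in> L \<Longrightarrow> z \<notin> L \<Longrightarrow> wp'' (z + p) = wp'' z"
  by (intro deriv_periodic holomorphic_wp' wp'_periodic)

lemma wp'_minus:
  assumes "z \<notin> L"
  shows "wp' (- z) = - wp' z"
proof -
  have "((\<lambda>z. wp (- z)) has_field_derivative wp' (- z) * (-1)) (at z)"
    using assms by (auto intro!: derivative_eq_intros)
  then have "(wp has_field_derivative - wp' (- z)) (at z)" by (simp add: wp_minus)
  then show ?thesis by (metis DERIV_imp_deriv minus_equation_iff)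
qed

lemma wp'_cnj:
  assumes "z \<notin> L"
  shows "wp' (cnj z) = cnj (wp' z)"
proof -
  have "(wp has_field_derivative wp' z) (at z)"
    using assms holomorphic_derivI[OF holomorphic_wp open_compl_L] by simp
  then have "(cnj \<circ> wp \<circ> cnj has_field_derivative cnj (wp' z)) (at (cnj z))"
    by (rule has_field_derivative_cnj_cnj[of _ _ "cnj z", simplified])
  moreover have "cnj \<circ> wp \<circ> cnj = wp" by (simp add: fun_eq_iff wp_cnj)
  ultimately show ?thesis by (simp add: DERIV_imp_deriv)
qed

text \<open>The points \<open>z\<close> and \<open>- z\<close> differ by a period, while
  \<open>wp'\<close> is odd.\<close>

lemma wp'_half_period_eq_0:
  assumes "2 * z \<in> L" "z \<notin> L"
  shows "wp' z = 0"
proof -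
  have "wp' z = wp' (- z + 2 * z)" by simp
  also have "\<dots> = wp' (- z)" using assms by (intro wp'_periodic) auto
  also have "\<dots> = - wp' z" by (rule wp'_minus[OF assms(2)])
  finally show ?thesis by simp
qed

section \<open>Laurent expansions at the origin and cancellation of principal parts\<close>

abbreviation "wp_rem' \<equiv> deriv wp_rem"
abbreviation "wp_rem'' \<equiv> deriv wp_rem'"

lemma has_field_derivative_wp_rem:
  assumes "z \<notin> L"
  shows "(wp_rem has_field_derivative wp_rem' z) (at z)" "(wp_rem' has_field_derivative wp_rem'' z) (at z)"
  using assms
  by (intro holomorphic_derivI[OF _ open_compl_L'] holomorphic_deriv[OF _ open_compl_L'] holomorphic_wp_rem; simp)+

text \<open>The values of these limits are immaterial: in the differential equations each remainder
  occurs with a positive power of \<open>z\<close>, so finiteness suffices.\<close>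

lemma tendsto_wp_rem:
  obtains c c' c'' where "wp_rem \<midarrow>0\<rightarrow> c" "wp_rem' \<midarrow>0\<rightarrow> c'" "wp_rem'' \<midarrow>0\<rightarrow> c''"
proof -
  have "isCont f 0" if "f holomorphic_on - (L - {0})" for f
    using that open_compl_L' by (metis Compl_iff DiffD2 continuous_on_eq_continuous_at
        holomorphic_on_imp_continuous_on singletonI)
  then show thesis
    using that holomorphic_wp_rem holomorphic_deriv[OF _ open_compl_L'] unfolding isCont_def by metis
qed

lemma wp_laurent:
  assumes "z \<notin> L"
  shows "wp z = 1 / z\<^sup>2 + (3 * G4 * z\<^sup>2 + 5 * G6 * z ^ 4 + z ^ 5 * wp_rem z)"
  using assms by (simp add: wp_conv_reg wp_reg_expansion)

lemma wp'_laurent: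
  assumes z: "z \<notin> L"
  shows "wp' z = - 2 / z ^ 3 + (6 * G4 * z + 20 * G6 * z ^ 3 + 5 * z ^ 4 * wp_rem z + z ^ 5 * wp_rem' z)"
proof (rule DERIV_imp_deriv, rule has_field_derivative_transform_within_open[OF _ open_compl_L])
  have "z \<noteq> 0" using z by auto
  then show "((\<lambda>z. 1 / z\<^sup>2 + (3 * G4 * z\<^sup>2 + 5 * G6 * z ^ 4 + z ^ 5 * wp_rem z)) has_field_derivative
      - 2 / z ^ 3 + (6 * G4 * z + 20 * G6 * z ^ 3 + 5 * z ^ 4 * wp_rem z + z ^ 5 * wp_rem' z)) (at z)"
    by (auto intro!: derivative_eq_intros has_field_derivative_wp_rem[OF z])
      (use z in \<open>auto simp: power_numeral_reduce algebra_simps divide_simps\<close>)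
qed (use z in \<open>auto simp: wp_laurent\<close>)

lemma wp''_laurent:
  assumes z: "z \<notin> L"
  shows "wp'' z = 6 / z ^ 4 + (6 * G4 + 60 * G6 * z\<^sup>2 + 20 * z ^ 3 * wp_rem z + 10 * z ^ 4 * wp_rem' z
    + z ^ 5 * wp_rem'' z)"
proof (rule DERIV_imp_deriv, rule has_field_derivative_transform_within_open[OF _ open_compl_L])
  have "z \<noteq> 0" using z by auto
  then show "((\<lambda>z. - 2 / z ^ 3 + (6 * G4 * z + 20 * G6 * z ^ 3 + 5 * z ^ 4 * wp_rem z + z ^ 5 * wp_rem' z)) has_field_derivative
      6 / z ^ 4 + (6 * G4 + 60 * G6 * z\<^sup>2 + 20 * z ^ 3 * wp_rem z + 10 * z ^ 4 * wp_rem' z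
    + z ^ 5 * wp_rem'' z)) (at z)"
    by (auto intro!: derivative_eq_intros has_field_derivative_wp_rem[OF z])
      (use z in \<open>auto simp: power_numeral_reduce algebra_simps divide_simps\<close>)
qed (use z in \<open>auto simp: wp'_laurent\<close>)

text \<open>The fourth-order poles cancel and the constant terms add up to
  \<open>6 * G4 - 36 * G4 + 30 * G4 = 0\<close>; every term that is left tends to 0.\<close>

lemma eventually_wp_ode:
  "eventually (\<lambda>z. wp'' z - 6 * (wp z)\<^sup>2 + 30 * G4 =
     (60 * G6 * z\<^sup>2 + 20 * z ^ 3 * wp_rem z + 10 * z ^ 4 * wp_rem' z + z ^ 5 * wp_rem'' z)
     - 12 * (5 * G6 * z\<^sup>2 + z ^ 3 * wp_rem z)
     - 6 * (3 * G4 * z\<^sup>2 + 5 * G6 * z ^ 4 + z ^ 5 * wp_rem z)\<^sup>2) (at 0)"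
  using eventually_not_in_L[of 0]
proof eventually_elim
  case (elim z)
  then have "z \<noteq> 0" by auto
  \<comment> \<open>Treating \<open>1 / z\<close> as a separate symbol subject to
    \<open>i * z = 1\<close> turns the claim into a polynomial identity modulo this
    relation.\<close>
  define i where "i = 1 / z"
  have i: "i * z = 1" using \<open>z \<noteq> 0\<close> by (simp add: i_def)
  have eq: "1 / z\<^sup>2 = i\<^sup>2" "6 / z ^ 4 = 6 * i ^ 4" by (auto simp: i_def power_one_over)
  show ?case unfolding wp_laurent[OF elim] wp''_laurent[OF elim] eq using i by algebra
qed

theorem wp''_eq:
  assumes "z \<notin> L"
  shows "wp'' z = 6 * (wp z)\<^sup>2 - 30 * G4"
proof -
  obtain c c' c'' where lims: "wp_rem \<midarrow>0\<rightarrow> c" "wp_rem' \<midarrow>0\<rightarrow> c'" "wp_rem'' \<midarrow>0\<rightarrow> c''"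
    by (rule tendsto_wp_rem)
  have "wp'' z - 6 * (wp z)\<^sup>2 + 30 * G4 = 0"
  proof (rule liouville_lattice[where f = "\<lambda>z. wp'' z - 6 * (wp z)\<^sup>2 + 30 * G4"])
    show "(\<lambda>z. wp'' z - 6 * (wp z)\<^sup>2 + 30 * G4) \<midarrow>0\<rightarrow> 0"
      by (subst tendsto_cong[OF eventually_wp_ode]) (auto intro!: tendsto_eq_intros lims)
  qed (use assms in \<open>auto intro!: holomorphic_intros holomorphic_wp holomorphic_wp'' simp: wp_periodic wp''_periodic\<close>)
  then show ?thesis by algebra
qed

text \<open>The poles of order 6 cancel, those of order 2 have coefficients
  \<open>- 24 * G4 - 36 * G4 + 60 * G4 = 0\<close>, and the constants are
  \<open>- 80 * G6 - 60 * G6 + 140 * G6 = 0\<close>.\<close>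

lemma eventually_wp_first_integral:
  "eventually (\<lambda>z. (wp' z)\<^sup>2 - 4 * wp z ^ 3 + 60 * G4 * wp z + 140 * G6 =
     - 4 * (5 * z * wp_rem z + z\<^sup>2 * wp_rem' z)
     + (6 * G4 * z + 20 * G6 * z ^ 3 + 5 * z ^ 4 * wp_rem z + z ^ 5 * wp_rem' z)\<^sup>2
     - 12 * z * wp_rem z - 12 * (z * (3 * G4 + 5 * G6 * z\<^sup>2 + z ^ 3 * wp_rem z))\<^sup>2
     - 4 * (3 * G4 * z\<^sup>2 + 5 * G6 * z ^ 4 + z ^ 5 * wp_rem z) ^ 3
     + 60 * G4 * (3 * G4 * z\<^sup>2 + 5 * G6 * z ^ 4 + z ^ 5 * wp_rem z)) (at 0)"
  using eventually_not_in_L[of 0]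
proof eventually_elim
  case (elim z)
  then have "z \<noteq> 0" by auto
  define i where "i = 1 / z"
  have i: "i * z = 1" using \<open>z \<noteq> 0\<close> by (simp add: i_def)
  have eq: "1 / z\<^sup>2 = i\<^sup>2" "- 2 / z ^ 3 = - 2 * i ^ 3" by (auto simp: i_def power_one_over)
  show ?case unfolding wp_laurent[OF elim] wp'_laurent[OF elim] eq using i by algebra
qed

theorem wp'_sq_eq:
  assumes "z \<notin> L"
  shows "(wp' z)\<^sup>2 = 4 * wp z ^ 3 - 60 * G4 * wp z - 140 * G6"
proof -
  obtain c c' c'' where lims: "wp_rem \<midarrow>0\<rightarrow> c" "wp_rem' \<midarrow>0\<rightarrow> c'" "wp_rem'' \<midarrow>0\<rightarrow> c''"
    by (rule tendsto_wp_rem)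
  have "(wp' z)\<^sup>2 - 4 * wp z ^ 3 + 60 * G4 * wp z + 140 * G6 = 0"
  proof (rule liouville_lattice[where f = "\<lambda>z. (wp' z)\<^sup>2 - 4 * wp z ^ 3 + 60 * G4 * wp z + 140 * G6"])
    show "(\<lambda>z. (wp' z)\<^sup>2 - 4 * wp z ^ 3 + 60 * G4 * wp z + 140 * G6) \<midarrow>0\<rightarrow> 0"
      by (subst tendsto_cong[OF eventually_wp_first_integral]) (auto intro!: tendsto_eq_intros lims)
  qed (use assms in \<open>auto intro!: holomorphic_intros holomorphic_wp holomorphic_wp' simp: wp_periodic wp'_periodic\<close>)
  then show ?thesis by algebra
qed

end

subsection \<open>Values at the half periods\<close>

text \<open>The difference \<open>h\<close> solves the linear equation \<open>h'' = q * h\<close>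
  with \<open>q = B + C * (f + g)\<close>. By the Leibniz rule a derivative of order m + 2 at
  \<open>z0\<close> is a combination of derivatives of order at most m, so strong induction kills
  the whole Taylor series.\<close>

lemma second_order_ode_unique:
  fixes f g :: "complex \<Rightarrow> complex"
  assumes f: "f holomorphic_on ball z0 r" and g: "g holomorphic_on ball z0 r"
    and odef: "\<And>z. z \<in> ball z0 r \<Longrightarrow> deriv (deriv f) z = A + B * f z + C * (f z)\<^sup>2"
    and odeg: "\<And>z. z \<in> ball z0 r \<Longrightarrow> deriv (deriv g) z = A + B * g z + C * (g z)\<^sup>2"
    and init: "f z0 = g z0" "deriv f z0 = deriv g z0" and z: "z \<in> ball z0 r"
  shows "f z = g z"
proof -
  define h where "h z = f z - g z" for z
  define q where "q z = B + C * (f z + g z)" for z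
  have z0: "z0 \<in> ball z0 r" using z by (metis centre_in_ball ball_empty empty_iff not_le)
  have h: "h holomorphic_on ball z0 r" and q: "q holomorphic_on ball z0 r"
    unfolding h_def q_def by (intro holomorphic_intros f g)+
  have h': "deriv h z = deriv f z - deriv g z" if "z \<in> ball z0 r" for z
    unfolding h_def using that f g by (intro deriv_diff) (auto intro: holomorphic_on_imp_differentiable_at)
  have h'': "deriv (deriv h) z = q z * h z" if "z \<in> ball z0 r" for z
  proof -
    have "deriv (deriv h) z = deriv (\<lambda>z. deriv f z - deriv g z) z"
      by (rule complex_derivative_transform_within_open[OF _ _ open_ball that])
        (use h' in \<open>auto intro!: holomorphic_intros holomorphic_deriv f g h\<close>)
    also have "\<dots> = deriv (deriv f) z - deriv (deriv g) z"
      using that f g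
      by (intro deriv_diff) (auto intro!: holomorphic_on_imp_differentiable_at[OF holomorphic_deriv])
    also have "\<dots> = q z * h z"
      unfolding odef[OF that] odeg[OF that] h_def q_def by (simp add: algebra_simps power2_eq_square)
    finally show ?thesis .
  qed
  have "(deriv ^^ n) h z0 = 0" for n
  proof (induction n rule: less_induct)
    case (less n)
    consider "n = 0" | "n = 1" | m where "n = Suc (Suc m)"
      by (metis One_nat_def not0_implies_Suc)
    then show ?case
    proof cases
      case 3
      have "(deriv ^^ n) h z0 = (deriv ^^ m) (deriv (deriv h)) z0"
        by (simp add: 3 funpow_swap1)
      also have "\<dots> = (deriv ^^ m) (\<lambda>z. q z * h z) z0"
        by (rule higher_deriv_transform_within_open[OF _ _ open_ball z0])
          (use h'' in \<open>auto intro!: holomorphic_intros holomorphic_deriv q h\<close>)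
      also have "\<dots> = (\<Sum>i = 0..m. of_nat (m choose i) * (deriv ^^ i) q z0 * (deriv ^^ (m-i)) h z0)"
        by (rule higher_deriv_mult[OF q h open_ball z0])
      also have "\<dots> = 0"
        by (rule sum.neutral) (use less 3 in auto)
      finally show ?thesis .
    next
      case 1
      then show ?thesis using init by (simp add: h_def)
    next
      case 2
      then show ?thesis using init h'[OF z0] by simp
    qed
  qed
  then have "h z = 0" by (rule holomorphic_fun_eq_0_on_ball[OF h z])
  then show ?thesis by (simp add: h_def)
qed

text \<open>A meromorphic difference on the connected plane either vanishes off a sparse set or is
  nonzero off a sparse set; agreement near \<open>z0\<close> rules out the second case.\<close>

lemma meromorphic_identity:
  assumes "f meromorphic_on UNIV" "g meromorphic_on UNIV" "eventually (\<lambda>z. f z = g z) (at z0)"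
  shows "eventually (\<lambda>z. f z = g z) (at z)"
proof -
  have "(\<lambda>z. f z - g z) meromorphic_on UNIV"
    using assms by (intro meromorphic_intros)
  from meromorphic_imp_constant_or_avoid[OF this open_UNIV connected_UNIV, of 0]
  show ?thesis
  proof
    assume "\<forall>\<^sub>\<approx>z\<in>UNIV. f z - g z = 0"
    then show ?thesis by (simp add: eventually_cosparse_open_eq)
  next
    assume "\<forall>\<^sub>\<approx>z\<in>UNIV. f z - g z \<noteq> 0"
    then have "eventually (\<lambda>z. f z - g z \<noteq> 0) (at z0)"
      by (simp add: eventually_cosparse_open_eq)
    with assms(3) have "eventually (\<lambda>z. False) (at z0)"
      by eventually_elim auto
    then show ?thesis by simp
  qed
qed

text \<open>Stepping down from \<open>\<infinity>\<close>, \<open>f\<close> cannot cross the gap between the two largest roots, where the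
  cubic is negative.\<close>
lemma value_eq_largest_root:
  fixes f :: "real \<Rightarrow> real"
  assumes t0: "0 < t0" and cont: "continuous_on {0<..t0} f"
    and lim: "filterlim f at_top (at_right 0)"
    and nonneg: "\<And>t. t \<in> {0<..t0} \<Longrightarrow> (f t - a) * (f t - b) * (f t - c) \<ge> 0"
    and ord: "b < a" "c < b" and root: "f t0 = a \<or> f t0 = b \<or> f t0 = c"
  shows "f t0 = a"
proof (rule ccontr)
  assume "f t0 \<noteq> a"
  define m where "m = (a + b) / 2"
  have m: "b < m" "m < a" using ord by (auto simp: m_def)
  have "eventually (\<lambda>t. f t > m) (at_right 0)"
    using lim by (simp add: filterlim_at_top_dense)
  moreover have "eventually (\<lambda>t. t \<in> {0<..<t0}) (at_right 0)"
    using t0 by (rule eventually_at_right_real)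
  ultimately have "eventually (\<lambda>t. f t > m \<and> t \<in> {0<..<t0}) (at_right 0)"
    by eventually_elim auto
  then obtain s where s: "f s > m" "0 < s" "s < t0"
    using eventually_happens trivial_limit_at_right_real by fastforce
  have "\<exists>t. s \<le> t \<and> t \<le> t0 \<and> f t = m"
    by (rule IVT2') (use s m root \<open>f t0 \<noteq> a\<close> ord in \<open>auto intro: continuous_on_subset[OF cont]\<close>)
  then obtain t where t: "s \<le> t" "t \<le> t0" "f t = m" by blast
  have "(f t - a) * ((f t - b) * (f t - c)) < 0"
    using t m ord by (intro mult_neg_pos mult_pos_pos) auto
  with nonneg[of t] t s show False by (auto simp: mult.assoc)
qed

section \<open>Poles of the Weierstrass function and separation of its half-period values\<close>

context rect_lattice
begin

lemma holomorphic_wp_reg_ball: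
  obtains r where "r > 0" "wp_reg holomorphic_on ball 0 r"
  using open_compl_L' holomorphic_wp_reg
  by (metis Compl_iff Diff_iff holomorphic_on_subset insertI1 openE)

lemma wp_near_pole:
  assumes "p \<in> L"
  obtains G r where "r > 0" "G holomorphic_on ball p r" "G p = 1"
    "eventually (\<lambda>z. wp z = G z / (z - p)\<^sup>2) (at p)"
proof -
  obtain r where r: "r > 0" "wp_reg holomorphic_on ball 0 r"
    by (rule holomorphic_wp_reg_ball)
  define G where "G z = 1 + (z - p)\<^sup>2 * wp_reg (z - p)" for z
  have "(\<lambda>z. wp_reg (z - p)) holomorphic_on ball p r"
    by (rule holomorphic_on_compose_gen[OF _ r(2), unfolded o_def])
      (auto simp: dist_norm norm_minus_commute intro!: holomorphic_intros)
  then have G: "G holomorphic_on ball p r"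
    unfolding G_def by (intro holomorphic_intros)
  have ev: "eventually (\<lambda>z. wp z = G z / (z - p)\<^sup>2) (at p)"
    using eventually_not_in_L[of p] eventually_neq_at_within[of p p UNIV]
  proof eventually_elim
    case (elim z)
    have "z - p \<notin> L" using elim assms add_in_L_iff[of p "z - p"] by simp
    with elim assms show ?case by (simp add: wp_near_lattice G_def field_simps)
  qed
  show thesis by (rule that[OF r(1) G _ ev]) (simp add: G_def)
qed

text \<open>Near a lattice point \<open>wp\<close> is a holomorphic numerator with value 1 divided
  by \<open>(z - p) ^ 2\<close>. The order is given for affine combinations because \<open>d\<close>
  turns out to be one, up to a translation.\<close>

lemma wp_at_lattice:
  assumes "p \<in> L"
  shows "wp meromorphic_on {p}" "is_pole wp p"
    and "b \<noteq> 0 \<Longrightarrow> zorder (\<lambda>z. a + b * wp z) p = -2"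
proof -
  obtain G r where r: "r > 0" and G: "G holomorphic_on ball p r" "G p = 1"
    and ev: "eventually (\<lambda>z. wp z = G z / (z - p)\<^sup>2) (at p)"
    using wp_near_pole[OF assms] by blast
  have "G meromorphic_on {p}"
    using G r by (meson analytic_at analytic_on_imp_meromorphic_on centre_in_ball open_ball)
  then have "(\<lambda>z. G z / (z - p)\<^sup>2) meromorphic_on {p}"
    by (intro meromorphic_intros)
  then show "wp meromorphic_on {p}"
    using meromorphic_on_cong[of "{p}" wp "\<lambda>z. G z / (z - p)\<^sup>2" "{p}"] ev by simp
  have "is_pole (\<lambda>z. G z / (z - p)\<^sup>2) p"
    by (rule is_pole_basic[OF G(1)]) (use r G in auto)
  then show "is_pole wp p" using is_pole_cong[OF ev refl] by simp
  assume b: "b \<noteq> 0"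
  have "zorder (\<lambda>z. a + b * (G z / (z - p)\<^sup>2)) p = -2"
    by (rule zorder_eqI[where g = "\<lambda>z. a * (z - p)\<^sup>2 + b * G z", OF open_ball])
      (use r G b in \<open>auto simp: power_int_minus field_simps intro!: holomorphic_intros\<close>)
  moreover have "eventually (\<lambda>z. a + b * wp z = a + b * (G z / (z - p)\<^sup>2)) (at p)"
    using ev by eventually_elim simp
  ultimately show "zorder (\<lambda>z. a + b * wp z) p = -2"
    using zorder_cong[OF _ refl] by metis
qed

lemma wp_analytic_at: "z \<notin> L \<Longrightarrow> wp analytic_on {z}"
  using holomorphic_wp open_compl_L by (auto simp: analytic_at)

lemma meromorphic_wp_shift: "(\<lambda>z. wp (z + c)) meromorphic_on UNIV"
proof -
  have "wp meromorphic_on UNIV"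
    by (subst meromorphic_on_meromorphic_at)
      (use wp_at_lattice wp_analytic_at analytic_on_imp_meromorphic_on in blast)
  then show ?thesis
    by (rule meromorphic_on_compose) (auto intro!: analytic_intros)
qed

lemma is_pole_wp_shift_iff: "is_pole (\<lambda>z. wp (z + c)) z \<longleftrightarrow> z + c \<in> L"
proof -
  have "is_pole (\<lambda>z. wp (z + c)) z \<longleftrightarrow> is_pole wp (z + c)"
    using is_pole_shift_iff[of wp c z] by (simp add: o_def add.commute)
  also have "\<dots> \<longleftrightarrow> z + c \<in> L"
    using wp_at_lattice wp_analytic_at analytic_at_imp_no_pole by blast
  finally show ?thesis .
qed

lemma ball_shift_disjoint_L:
  assumes "a \<notin> L"
  obtains r where "r > 0" "\<And>z. z \<in> ball 0 r \<Longrightarrow> z + a \<notin> L"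
proof -
  obtain r where "r > 0" "ball a r \<subseteq> - L"
    using open_compl_L assms by (meson Compl_iff openE)
  then show thesis by (intro that[of r]) (auto simp: dist_norm norm_minus_commute subset_iff)
qed

lemma deriv_wp_shift:
  assumes "z + a \<notin> L"
  shows "deriv (\<lambda>z. wp (z + a)) z = wp' (z + a)"
    and "deriv (deriv (\<lambda>z. wp (z + a))) z = wp'' (z + a)"
proof -
  have 1: "((\<lambda>z. wp (z + a)) has_field_derivative wp' (z + a)) (at z)" if "z + a \<notin> L" for z
    using that by (auto intro!: derivative_eq_intros)
  then show "deriv (\<lambda>z. wp (z + a)) z = wp' (z + a)" using assms DERIV_imp_deriv by blast
  have "open ((\<lambda>z. z + a) -` (- L))"
    by (intro open_vimage open_compl_L continuous_intros)
  moreover have "((\<lambda>z. wp' (z + a)) has_field_derivative wp'' (z + a)) (at z)"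
    using assms by (auto intro!: derivative_eq_intros)
  ultimately have "(deriv (\<lambda>z. wp (z + a)) has_field_derivative wp'' (z + a)) (at z)"
    using assms by (elim has_field_derivative_transform_within_open) (auto simp: DERIV_imp_deriv[OF 1])
  then show "deriv (deriv (\<lambda>z. wp (z + a))) z = wp'' (z + a)" by (rule DERIV_imp_deriv)
qed

text \<open>The translates of \<open>wp\<close> by \<open>a\<close> and by \<open>b\<close> solve
  the same second-order equation, with equal values and zero derivatives at 0. Hence they coincide,
  and the pole of the first one at \<open>- a\<close> must be a pole of the second.\<close>

lemma wp_half_periods_distinct:
  assumes a: "2 * a \<in> L" "a \<notin> L" and b: "2 * b \<in> L" "b \<notin> L" and eq: "wp a = wp b"
  shows "a - b \<in> L"
proof -
  obtain r1 r2 where r1: "r1 > 0" "\<And>z. z \<in> ball 0 r1 \<Longrightarrow> z + a \<notin> L"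
    and r2: "r2 > 0" "\<And>z. z \<in> ball 0 r2 \<Longrightarrow> z + b \<notin> L"
    using ball_shift_disjoint_L[OF a(2)] ball_shift_disjoint_L[OF b(2)] by metis
  define r where "r = min r1 r2"
  have r: "r > 0" "\<And>z. z \<in> ball 0 r \<Longrightarrow> z + a \<notin> L" "\<And>z. z \<in> ball 0 r \<Longrightarrow> z + b \<notin> L"
    using r1 r2 by (auto simp: r_def)
  have hol: "(\<lambda>z. wp (z + c)) holomorphic_on ball 0 r" if "\<And>z. z \<in> ball 0 r \<Longrightarrow> z + c \<notin> L" for c
    by (rule holomorphic_on_compose_gen[OF _ holomorphic_wp, unfolded o_def])
      (use that in \<open>auto intro!: holomorphic_intros\<close>)
  have ode: "deriv (deriv (\<lambda>z. wp (z + c))) z = - 30 * G4 + 0 * wp (z + c) + 6 * (wp (z + c))\<^sup>2"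
    if "z + c \<notin> L" for z c
    using that by (simp add: deriv_wp_shift wp''_eq)
  have init: "deriv (\<lambda>z. wp (z + a)) 0 = deriv (\<lambda>z. wp (z + b)) 0"
    using a b by (simp add: deriv_wp_shift wp'_half_period_eq_0)
  have "wp (z + a) = wp (z + b)" if "z \<in> ball 0 r" for z
    by (rule second_order_ode_unique[OF hol[OF r(2)] hol[OF r(3)] ode[OF r(2)] ode[OF r(3)] _ init that])
      (use eq in auto)
  then have "eventually (\<lambda>z. wp (z + a) = wp (z + b)) (at 0)"
    using r(1) by (intro eventually_at_in_open'[THEN eventually_mono, of "ball 0 r"]) auto
  from meromorphic_identity[OF meromorphic_wp_shift meromorphic_wp_shift this]
  have "is_pole (\<lambda>z. wp (z + a)) (- a) \<longleftrightarrow> is_pole (\<lambda>z. wp (z + b)) (- a)"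
    by (intro is_pole_cong) auto
  then have "b - a \<in> L" by (simp add: is_pole_wp_shift_iff)
  then show ?thesis using minus_in_L_iff[of "b - a"] by simp
qed

lemma real_not_in_L: "0 < t \<Longrightarrow> t < 2 * w \<Longrightarrow> of_real t \<notin> L"
  and imag_not_in_L: "0 < t \<Longrightarrow> t < 2 * w' \<Longrightarrow> \<i> * of_real t \<notin> L"
proof -
  have *: False if "0 < t" "t < 2 * v" "t = 2 * v * real_of_int m" for t v m
  proof -
    have "v > 0" using that by linarith
    with that have "0 < real_of_int m" "real_of_int m < 1"
      by (auto simp: zero_less_mult_iff)
    then show False by simp
  qed
  show "0 < t \<Longrightarrow> t < 2 * w \<Longrightarrow> of_real t \<notin> L" "0 < t \<Longrightarrow> t < 2 * w' \<Longrightarrow> \<i> * of_real t \<notin> L"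
    using * by (auto simp: L_iff)
qed

lemma isCont_wp_reg: "isCont wp_reg 0"
  using holomorphic_wp_reg open_compl_L'
  by (metis Compl_iff DiffD2 continuous_on_eq_continuous_at holomorphic_on_imp_continuous_on singletonI)

lemma continuous_on_wp: "continuous_on A g \<Longrightarrow> (\<And>x. x \<in> A \<Longrightarrow> g x \<notin> L) \<Longrightarrow> continuous_on A (\<lambda>x. wp (g x))"
  using continuous_on_compose2[OF holomorphic_on_imp_continuous_on[OF holomorphic_wp]] by auto

section \<open>Half-period values as the ordered roots of the cubic\<close>

context
  fixes e1 e2 e3 :: real
  assumes ord: "e3 < e2" "e2 < e1"
    and sum0: "e1 + e2 + e3 = 0"
    and g2: "60 * G4 = - 4 * of_real (e1 * e2 + e1 * e3 + e2 * e3)"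
    and g3: "140 * G6 = 4 * of_real (e1 * e2 * e3)"
begin

lemma wp'_sq_factored:
  assumes "z \<notin> L"
  shows "(wp' z)\<^sup>2 = 4 * ((wp z - of_real e1) * (wp z - of_real e2) * (wp z - of_real e3))"
proof -
  have "e3 = - e1 - e2" using sum0 by simp
  then have e3: "complex_of_real e3 = - of_real e1 - of_real e2" by simp
  have "4 * x ^ 3 - (- 4 * (a * b + a * c + b * c)) * x - 4 * (a * b * c) = 4 * ((x - a) * (x - b) * (x - c))"
    if "c = - a - b" for a b c x :: complex
    using that by algebra
  from this[OF e3, of "wp z"] show ?thesis
    unfolding wp'_sq_eq[OF assms] g2 g3 by (simp only: of_real_add of_real_mult)
qed

lemma wp_half_period_root:
  assumes "2 * z \<in> L" "z \<notin> L"
  shows "wp z = of_real e1 \<or> wp z = of_real e2 \<or> wp z = of_real e3"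
  using wp'_sq_factored[OF assms(2)] wp'_half_period_eq_0[OF assms] by auto

text \<open>On the real axis conjugation symmetry makes \<open>wp\<close> and \<open>wp'\<close>
  real, so the cubic is a quarter of a real square and nonnegative. The function comes down from
  infinity and cannot cross the gap below the largest root, while its value at \<open>w\<close> is a
  root.\<close>

lemma wp_w: "wp (of_real w) = of_real e1"
proof -
  have nL: "of_real t \<notin> L" if "t \<in> {0<..w}" for t
    using that w_pos by (intro real_not_in_L) auto
  have re: "wp (of_real t) = of_real (Re (wp (of_real t)))" for t
    using wp_cnj[of "of_real t"] by (simp add: complex_eq_iff)
  have "Re (wp (of_real w)) = e1"
  proof (rule value_eq_largest_root[OF w_pos, where f = "\<lambda>t. Re (wp (of_real t))" and b = e2 and c = e3])
    show "continuous_on {0<..w} (\<lambda>t. Re (wp (of_real t)))"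
      by (intro continuous_intros continuous_on_wp nL)
    have "((\<lambda>t. Re (wp_reg (complex_of_real t))) \<longlongrightarrow> Re (wp_reg 0)) (at_right 0)"
      by (intro tendsto_Re isCont_tendsto_compose[OF isCont_wp_reg] tendsto_eq_intros) auto
    moreover have "filterlim (\<lambda>t::real. 1 / t\<^sup>2) at_top (at_right 0)"
      by real_asymp
    ultimately have "filterlim (\<lambda>t. Re (wp_reg (complex_of_real t)) + 1 / t\<^sup>2) at_top (at_right 0)"
      by (rule filterlim_tendsto_add_at_top)
    also have "?this \<longleftrightarrow> filterlim (\<lambda>t. Re (wp (complex_of_real t))) at_top (at_right 0)"
    proof (intro filterlim_cong refl)
      show "\<forall>\<^sub>F t in at_right 0. Re (wp_reg (complex_of_real t)) + 1 / t\<^sup>2 = Re (wp (complex_of_real t))"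
        using eventually_at_right_real[OF w_pos]
      proof eventually_elim
        case (elim t)
        then have "wp (of_real t) = of_real (1 / t\<^sup>2) + wp_reg (of_real t)"
          using nL[of t] by (simp add: wp_conv_reg)
        then show ?case by (simp only: plus_complex.sel Re_complex_of_real)
      qed
    qed
    finally show "filterlim (\<lambda>t. Re (wp (complex_of_real t))) at_top (at_right 0)" .
    show "(Re (wp (of_real t)) - e1) * (Re (wp (of_real t)) - e2) * (Re (wp (of_real t)) - e3) \<ge> 0"
      if t: "t \<in> {0<..w}" for t
    proof -
      have "wp' (of_real t) = of_real (Re (wp' (of_real t)))"
        using wp'_cnj[OF nL[OF t]] by (simp add: complex_eq_iff)
      with wp'_sq_factored[OF nL[OF t]] re[of t]
      have "complex_of_real ((Re (wp' (of_real t)))\<^sup>2) = of_real (4 * ((Re (wp (of_real t)) - e1)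
          * (Re (wp (of_real t)) - e2) * (Re (wp (of_real t)) - e3)))"
        by (metis of_real_diff of_real_mult of_real_numeral of_real_power)
      then show ?thesis by (metis of_real_eq_iff zero_le_power2 zero_le_mult_iff not_numeral_le_zero zero_less_numeral)
    qed
    show "Re (wp (of_real w)) = e1 \<or> Re (wp (of_real w)) = e2 \<or> Re (wp (of_real w)) = e3"
      using wp_half_period_root[of "of_real w"] half_not_in_L by auto
  qed (use ord in auto)
  with re[of w] show ?thesis by simp
qed

text \<open>On the imaginary axis \<open>wp\<close> is real and \<open>wp'\<close> purely imaginary,
  so the cubic is nonpositive. Passing to \<open>- wp\<close> reverses the order of the roots and
  restores the situation of a function descending from infinity.\<close>

lemma wp_iw': "wp (\<i> * of_real w') = of_real e3"
proof -
  have nL: "\<i> * of_real t \<notin> L" if "t \<in> {0<..w'}" for t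
    using that w'_pos by (intro imag_not_in_L) auto
  have re: "wp (\<i> * of_real t) = of_real (Re (wp (\<i> * of_real t)))" for t
    using wp_cnj[of "\<i> * of_real t"] wp_minus[of "\<i> * of_real t"] by (simp add: complex_eq_iff)
  have "- Re (wp (\<i> * of_real w')) = - e3"
  proof (rule value_eq_largest_root[OF w'_pos, where f = "\<lambda>t. - Re (wp (\<i> * of_real t))" and b = "- e2" and c = "- e1"])
    show "continuous_on {0<..w'} (\<lambda>t. - Re (wp (\<i> * of_real t)))"
      by (intro continuous_intros continuous_on_wp nL)
    have "((\<lambda>t. - Re (wp_reg (\<i> * complex_of_real t))) \<longlongrightarrow> - Re (wp_reg 0)) (at_right 0)"
      by (intro tendsto_minus tendsto_Re isCont_tendsto_compose[OF isCont_wp_reg] tendsto_eq_intros) auto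
    moreover have "filterlim (\<lambda>t::real. 1 / t\<^sup>2) at_top (at_right 0)"
      by real_asymp
    ultimately have "filterlim (\<lambda>t. - Re (wp_reg (\<i> * complex_of_real t)) + 1 / t\<^sup>2) at_top (at_right 0)"
      by (rule filterlim_tendsto_add_at_top)
    also have "?this \<longleftrightarrow> filterlim (\<lambda>t. - Re (wp (\<i> * complex_of_real t))) at_top (at_right 0)"
    proof (intro filterlim_cong refl)
      show "\<forall>\<^sub>F t in at_right 0. - Re (wp_reg (\<i> * complex_of_real t)) + 1 / t\<^sup>2 = - Re (wp (\<i> * complex_of_real t))"
        using eventually_at_right_real[OF w'_pos]
      proof eventually_elim
        case (elim t)
        then have "wp (\<i> * of_real t) = of_real (- 1 / t\<^sup>2) + wp_reg (\<i> * of_real t)"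
          using nL[of t] by (simp add: wp_conv_reg power_mult_distrib)
        then show ?case by (simp only: plus_complex.sel Re_complex_of_real)
      qed
    qed
    finally show "filterlim (\<lambda>t. - Re (wp (\<i> * complex_of_real t))) at_top (at_right 0)" .
    show "(- Re (wp (\<i> * of_real t)) - (- e3)) * (- Re (wp (\<i> * of_real t)) - (- e2))
        * (- Re (wp (\<i> * of_real t)) - (- e1)) \<ge> 0" if t: "t \<in> {0<..w'}" for t
    proof -
      define x where "x = Re (wp (\<i> * of_real t))"
      define y where "y = Im (wp' (\<i> * of_real t))"
      have "wp' (\<i> * of_real t) = \<i> * of_real y"
        using wp'_cnj[OF nL[OF t]] wp'_minus[OF nL[OF t]] by (simp add: complex_eq_iff y_def)
      with wp'_sq_factored[OF nL[OF t]] re[of t, folded x_def]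
      have "(\<i> * of_real y)\<^sup>2 = of_real (4 * ((x - e1) * (x - e2) * (x - e3)))"
        by (metis of_real_diff of_real_mult of_real_numeral)
      then have "complex_of_real (- (y\<^sup>2)) = of_real (4 * ((x - e1) * (x - e2) * (x - e3)))"
        by (simp add: power_mult_distrib)
      then have "- (y\<^sup>2) = 4 * ((x - e1) * (x - e2) * (x - e3))" by (simp only: of_real_eq_iff)
      then have "(x - e1) * (x - e2) * (x - e3) \<le> 0" using zero_le_power2[of y] by linarith
      moreover have "(- x - (- e3)) * (- x - (- e2)) * (- x - (- e1)) = - ((x - e1) * (x - e2) * (x - e3))"
        by algebra
      ultimately show ?thesis unfolding x_def by linarith
    qed
    show "- Re (wp (\<i> * of_real w')) = - e3 \<or> - Re (wp (\<i> * of_real w')) = - e2 \<or> - Re (wp (\<i> * of_real w')) = - e1"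
      using wp_half_period_root[of "\<i> * of_real w'"] half_not_in_L by auto
  qed (use ord in auto)
  with re[of w'] show ?thesis by simp
qed

text \<open>The roots \<open>e1\<close> and \<open>e3\<close> are already taken at half periods that
  are incongruent to this one, so only \<open>e2\<close> remains.\<close>

lemma wp_w_iw': "wp (of_real w + \<i> * of_real w') = of_real e2"
proof -
  define a where "a = of_real w + \<i> * complex_of_real w'"
  have "2 * a = 2 * of_real w + 2 * (\<i> * of_real w')" by (simp add: a_def)
  then have a: "2 * a \<in> L" "a \<notin> L"
    by (auto simp: add_in_L a_def half_not_in_L)
  have "wp a \<noteq> of_real e1"
    using wp_half_periods_distinct[OF a, of "of_real w"] half_not_in_L[of "a - of_real w"]
      half_not_in_L[of "of_real w"] wp_w by (auto simp: a_def)
  moreover have "wp a \<noteq> of_real e3"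
    using wp_half_periods_distinct[OF a, of "\<i> * of_real w'"] half_not_in_L[of "a - \<i> * of_real w'"]
      half_not_in_L[of "\<i> * of_real w'"] wp_iw' by (auto simp: a_def)
  ultimately show ?thesis using wp_half_period_root[OF a] by (auto simp: a_def)
qed

text \<open>The first derivative vanishes at a half period, and the second one equals
  \<open>2 * (e - f) * (e - g)\<close>, where \<open>e\<close> is the value and \<open>f\<close>,
  \<open>g\<close> are the other roots; simplicity of the roots makes it nonzero.\<close>

lemma zorder_wp_half_period:
  assumes a: "2 * a \<in> L" "a \<notin> L"
  shows "zorder (\<lambda>z. wp z - wp a) a = 2"
proof (rule zorder_zero_eqI[of _ "- L"])
  have d1: "deriv (\<lambda>z. wp z - wp a) z = wp' z" if "z \<notin> L" for z
    by (rule DERIV_imp_deriv) (use that in \<open>auto intro!: derivative_eq_intros\<close>)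
  have d2: "deriv (deriv (\<lambda>z. wp z - wp a)) a = wp'' a"
    by (rule complex_derivative_transform_within_open[OF _ _ open_compl_L])
      (use a d1 in \<open>auto intro!: holomorphic_intros holomorphic_deriv open_compl_L holomorphic_wp\<close>)
  show "(deriv ^^ i) (\<lambda>z. wp z - wp a) a = 0" if "i < nat 2" for i
  proof -
    from that have "i = 0 \<or> i = 1" by auto
    then show ?thesis using d1[OF a(2)] wp'_half_period_eq_0[OF a] by auto
  qed
  obtain e f g where e: "wp a = of_real e" and efg: "e \<noteq> f" "e \<noteq> g" "e + f + g = 0"
      "e1 * e2 + e1 * e3 + e2 * e3 = e * f + e * g + f * g"
    using wp_half_period_root[OF a] ord sum0 by (smt (verit) mult.commute)
  have "wp'' a = of_real (6 * e\<^sup>2 + 2 * (e * f + e * g + f * g))"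
  proof -
    have "30 * G4 = 60 * G4 / 2" by simp
    also have "\<dots> = - 2 * of_real (e * f + e * g + f * g)" unfolding g2 efg(4) by simp
    finally show ?thesis unfolding wp''_eq[OF a(2)] e by simp
  qed
  also have "6 * e\<^sup>2 + 2 * (e * f + e * g + f * g) = 2 * (e - f) * (e - g)"
    using efg(3) by algebra
  finally show "(deriv ^^ nat 2) (\<lambda>z. wp z - wp a) a \<noteq> 0"
    using d2 efg by (simp add: eval_nat_numeral)
qed (use a in \<open>auto intro!: holomorphic_intros holomorphic_wp open_compl_L\<close>)

end

end

subsection \<open>The hypergeometric integral\<close>

lemma zorder_comp_shift:
  fixes f :: "complex \<Rightarrow> complex"
  shows "zorder (\<lambda>z. f (z + c)) a = zorder f (a + c)"
  by (subst zorder_shift, subst (2) zorder_shift) (simp add: add_ac)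

text \<open>By the duplication formulas for the Pochhammer symbol and the factorial, the
  hypergeometric coefficients are the even-indexed binomial coefficients for exponent -1/2. The
  series is thus the even part of a binomial series.\<close>

lemma hyp2F1_quarter:
  assumes "norm s < 1"
  shows "hyp2F1 (1/4) (3/4) (1/2) (s\<^sup>2) = ((1 + s) powr (-1/2) + (1 - s) powr (-1/2)) / 2"
proof -
  define c where "c n = (-1/2 :: complex) gchoose n" for n
  have coeff: "c (2 * n) = pochhammer (1/4) n * pochhammer (3/4) n / (pochhammer (1/2) n * fact n)" for n
  proof -
    have "c (2 * n) = pochhammer (2 * (1/4)) (2 * n) / fact (2 * n)"
      by (simp add: c_def gbinomial_pochhammer)
    also have "\<dots> = (of_nat (2 ^ (2 * n)) * (pochhammer (1/4) n * pochhammer (1/4 + 1/2) n)) /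
        (of_nat (2 ^ (2 * n)) * (pochhammer (1/2) n * fact n))"
      unfolding pochhammer_double fact_double by (simp add: mult_ac)
    also have "\<dots> = pochhammer (1/4) n * pochhammer (3/4) n / (pochhammer (1/2) n * fact n)"
      by simp
    finally show ?thesis .
  qed
  have 1: "(\<lambda>n. c n * s ^ n) sums ((1 + s) powr (-1/2))"
    unfolding c_def using assms by (rule gen_binomial_complex)
  have 2: "(\<lambda>n. c n * (- s) ^ n) sums ((1 - s) powr (-1/2))"
    using gen_binomial_complex[of "- s" "-1/2"] assms by (simp add: c_def)
  have "(\<lambda>n. (c n * s ^ n + c n * (- s) ^ n) / 2) sums (((1 + s) powr (-1/2) + (1 - s) powr (-1/2)) / 2)"
    by (intro sums_divide sums_add 1 2)
  then have "(\<lambda>n. (c (2 * n) * s ^ (2 * n) + c (2 * n) * (- s) ^ (2 * n)) / 2) sums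
      (((1 + s) powr (-1/2) + (1 - s) powr (-1/2)) / 2)"
  \<comment> \<open>Odd terms cancel in the average over \<open>s\<close> and \<open>- s\<close>, so
    summation may run over the even indices alone.\<close>
  proof (subst sums_mono_reindex[of "\<lambda>n. 2 * n"])
    fix n assume "n \<notin> range (\<lambda>n::nat. 2 * n)"
    then have "odd n" by (auto elim: evenE)
    then show "(c n * s ^ n + c n * (- s) ^ n) / 2 = 0" by simp
  qed (auto simp: strict_mono_def)
  then have "(\<lambda>n. c (2 * n) * (s\<^sup>2) ^ n) sums (((1 + s) powr (-1/2) + (1 - s) powr (-1/2)) / 2)"
    by (simp add: power_mult)
  then show ?thesis
    unfolding hyp2F1_def coeff by (rule sums_unique[symmetric])
qed

text \<open>Positivity of the real part identifies \<open>v\<close> as the principal square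
  root.\<close>

lemma powr_minus_half:
  assumes "v\<^sup>2 = x" "Re v > 0"
  shows "x powr (-1/2) = 1 / v"
proof -
  have "csqrt x = v" by (rule csqrt_unique) (use assms in auto)
  moreover have "x \<noteq> 0" using assms by auto
  ultimately have "exp (Ln x / 2) = v" by (simp add: csqrt_exp_Ln)
  then show ?thesis using \<open>x \<noteq> 0\<close> by (auto simp: powr_def exp_minus field_simps)
qed

text \<open>Here \<open>1 + sin x\<close> and \<open>1 - sin x\<close> are the squares of
  \<open>c + s\<close> and \<open>c - s\<close>, the sign conditions fix the roots, and
  \<open>cos x\<close> is the product \<open>(c + s) * (c - s)\<close>.\<close>

lemma hyp2F1_quarter_sin:
  assumes "norm (sin x) < 1" "Re (cos (x/2) + sin (x/2)) > 0" "Re (cos (x/2) - sin (x/2)) > 0"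
  shows "hyp2F1 (1/4) (3/4) (1/2) ((sin x)\<^sup>2) = cos (x/2) / cos x"
proof -
  define c s where "c = cos (x/2)" and "s = sin (x/2)"
  have cs: "c\<^sup>2 + s\<^sup>2 = 1" "sin x = 2 * s * c" "cos x = (c + s) * (c - s)"
    using sin_double[of "x/2"] cos_double[of "x/2"] by (auto simp: c_def s_def power2_eq_square algebra_simps)
  have p1: "(1 + sin x) powr (-1/2) = 1 / (c + s)"
    by (rule powr_minus_half) (use assms cs in \<open>auto simp: c_def s_def power2_eq_square algebra_simps\<close>)
  have p2: "(1 - sin x) powr (-1/2) = 1 / (c - s)"
    by (rule powr_minus_half) (use assms cs in \<open>auto simp: c_def s_def power2_eq_square algebra_simps\<close>)
  have "c + s \<noteq> 0" "c - s \<noteq> 0" using assms(2,3) unfolding c_def s_def by force+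
  then have "1 / (c + s) + 1 / (c - s) = 2 * c / ((c + s) * (c - s))"
    by (simp add: add_frac_eq)
  then show ?thesis
    unfolding hyp2F1_quarter[OF assms(1)] cs(3) p1 p2 c_def[symmetric] by simp
qed

text \<open>The closed form shows that the integrand is holomorphic on a disc where
  \<open>k * sin t\<close> has norm below 1, which keeps both bases off the branch cut. On this
  convex disc a primitive exists, and the segment integral is its increment.\<close>

lemma has_field_derivative_u_int:
  obtains r where "r > 0" "\<And>t. t \<in> ball 0 r \<Longrightarrow> norm (complex_of_real k * sin t) < 1"
    "\<And>t. t \<in> ball 0 r \<Longrightarrow>
      (u_int k has_field_derivative hyp2F1 (1/4) (3/4) (1/2) ((complex_of_real k * sin t)\<^sup>2)) (at t)"
proof -
  define S where "S = (\<lambda>t. norm (complex_of_real k * sin t)) -` {..<1}"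
  have "open S" unfolding S_def
    by (intro open_vimage continuous_intros open_lessThan)
  moreover have "0 \<in> S" by (simp add: S_def)
  ultimately obtain r where r: "r > 0" "ball 0 r \<subseteq> S" by (rule openE)
  define f where "f t = hyp2F1 (1/4) (3/4) (1/2) ((complex_of_real k)\<^sup>2 * (sin t)\<^sup>2)" for t
  have f_eq: "f t = hyp2F1 (1/4) (3/4) (1/2) ((complex_of_real k * sin t)\<^sup>2)" for t
    by (simp add: f_def power_mult_distrib)
  have le1: "norm (complex_of_real k * sin t) < 1" if "t \<in> ball 0 r" for t
    using r(2) that by (auto simp: S_def)
  have not_neg: "1 + v \<notin> \<real>\<^sub>\<le>\<^sub>0" if "norm v < 1" for v :: complex
    using that abs_Re_le_cmod[of v] by (auto simp: complex_nonpos_Reals_iff)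
  have "(\<lambda>t. ((1 + complex_of_real k * sin t) powr (-1/2) + (1 - complex_of_real k * sin t) powr (-1/2)) / 2)
      holomorphic_on ball 0 r"
    using not_neg[OF le1] not_neg[of "- (complex_of_real k * sin t)" for t] le1
    by (auto intro!: holomorphic_intros)
  then have "f holomorphic_on ball 0 r"
    by (rule holomorphic_transform) (use hyp2F1_quarter[OF le1] f_eq in auto)
  then obtain G where G: "\<And>x. x \<in> ball 0 r \<Longrightarrow> (G has_field_derivative f x) (at x within ball 0 r)"
    using holomorphic_convex_primitive'[OF convex_ball open_ball] by blast
  have u: "G t - G 0 = u_int k t" if "t \<in> ball 0 r" for t
  proof -
    have "path_image (linepath 0 t) \<subseteq> ball 0 r"
      using that r(1) by (simp add: closed_segment_subset)
    then have "(f has_contour_integral (G t - G 0)) (linepath 0 t)"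
      using contour_integral_primitive[OF G, of "linepath 0 t"] by simp
    then show ?thesis
      unfolding u_int_def f_def[symmetric] by (rule contour_integral_unique[symmetric])
  qed
  show thesis
  proof (rule that[OF r(1) le1])
    fix t :: complex assume t: "t \<in> ball 0 r"
    have "(G has_field_derivative f t) (at t)"
      using G[OF t] unfolding at_within_open[OF t open_ball] .
    then have "((\<lambda>t. G t - G 0) has_field_derivative f t) (at t)"
      by (auto intro!: derivative_eq_intros)
    then have "(u_int k has_field_derivative f t) (at t)"
      by (rule has_field_derivative_transform_within_open[OF _ open_ball t]) (rule u)
    then show "(u_int k has_field_derivative hyp2F1 (1/4) (3/4) (1/2) ((complex_of_real k * sin t)\<^sup>2)) (at t)"
      by (simp add: f_eq)
  qed
qed

text \<open>With \<open>c = cos (psi/2)\<close>, \<open>s = sin (psi/2)\<close> one has \<open>du/dphi = c / cos psi\<close>, hence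
  \<open>psi' = k cos phi / c\<close> and \<open>(cos psi)' = - 2 k s cos phi\<close>. Differentiating once more gives an
  equation in \<open>cos psi\<close> alone, and no branch of a square root is involved.\<close>
lemma cos_psi_ode:
  fixes k :: real and phi psi :: "complex \<Rightarrow> complex"
  assumes U: "open U" "0 \<in> U"
    and phi: "continuous_on U phi" "phi 0 = 0" "\<forall>u\<in>U. u_int k (phi u) = u"
    and psi: "continuous_on U psi" "psi 0 = 0"
             "\<forall>u\<in>U. sin (psi u) = complex_of_real k * sin (phi u)"
  obtains r where "r > 0" "ball 0 r \<subseteq> U" "(\<lambda>u. cos (psi u)) holomorphic_on ball 0 r"
    "deriv (\<lambda>u. cos (psi u)) 0 = 0"
    "\<And>u. u \<in> ball 0 r \<Longrightarrow> deriv (deriv (\<lambda>u. cos (psi u))) u =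
       (1 - (of_real k)\<^sup>2) + 2 * cos (psi u) - 3 * (cos (psi u))\<^sup>2"
proof -
  obtain \<rho> where \<rho>: "\<rho> > 0" "\<And>t. t \<in> ball 0 \<rho> \<Longrightarrow> norm (complex_of_real k * sin t) < 1"
    "\<And>t. t \<in> ball 0 \<rho> \<Longrightarrow>
      (u_int k has_field_derivative hyp2F1 (1/4) (3/4) (1/2) ((complex_of_real k * sin t)\<^sup>2)) (at t)"
    using has_field_derivative_u_int by blast
  \<comment> \<open>The strip makes \<open>Arcsin\<close> invert the sine at \<open>psi u\<close>;
    the other two conditions fix the square roots in the hypergeometric closed form.\<close>
  define B where "B = {x::complex. \<bar>Re x\<bar> < pi/2} \<inter> {x. Re (cos (x/2) + sin (x/2)) > 0}
    \<inter> {x. Re (cos (x/2) - sin (x/2)) > 0}"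
  have "open B" unfolding B_def
    by (intro open_Int open_Collect_less continuous_intros) auto
  define V where "V = (U \<inter> phi -` ball 0 \<rho>) \<inter> (U \<inter> psi -` B)"
  have "open V"
    unfolding V_def by (intro open_Int continuous_open_preimage phi psi U open_ball \<open>open B\<close>)
  moreover have "0 \<in> V" using U phi psi \<rho>(1) by (auto simp: V_def B_def)
  ultimately obtain r where r: "r > 0" "ball 0 r \<subseteq> V" by (rule openE)
  define D' where "D' u = - 2 * of_real k * sin (psi u / 2) * cos (phi u)" for u
  have main: "((\<lambda>u. cos (psi u)) has_field_derivative D' u) (at u)"
    "(D' has_field_derivative (1 - (of_real k)\<^sup>2) + 2 * cos (psi u) - 3 * (cos (psi u))\<^sup>2) (at u)"
    if u: "u \<in> V" for u
  proof -
    have uU: "u \<in> U" and phi_u: "phi u \<in> ball 0 \<rho>" and psi_u: "psi u \<in> B" using u by (auto simp: V_def)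
    define c s where "c = cos (psi u / 2)" and "s = sin (psi u / 2)"
    have cs: "c\<^sup>2 + s\<^sup>2 = 1" "sin (psi u) = 2 * s * c" "cos (psi u) = (c + s) * (c - s)"
      using sin_double[of "psi u / 2"] cos_double[of "psi u / 2"]
      by (auto simp: c_def s_def power2_eq_square algebra_simps)
    have pos: "Re (c + s) > 0" "Re (c - s) > 0" using psi_u by (auto simp: B_def c_def s_def)
    have "c + s \<noteq> 0" "c - s \<noteq> 0" using pos by force+
    then have nz: "cos (psi u) \<noteq> 0" "c \<noteq> 0"
      using pos cs(3) by auto
    have sin_eq: "sin (psi u) = of_real k * sin (phi u)" using psi uU by auto
    have lt1: "norm (sin (psi u)) < 1" using \<rho>(2)[OF phi_u] sin_eq by simp
    have "hyp2F1 (1/4) (3/4) (1/2) ((of_real k * sin (phi u))\<^sup>2) = c / cos (psi u)"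
      using hyp2F1_quarter_sin[of "psi u"] lt1 pos by (simp add: sin_eq c_def s_def)
    then have "(u_int k has_field_derivative c / cos (psi u)) (at (phi u))"
      using \<rho>(3)[OF phi_u] by simp
    then have "(phi has_field_derivative inverse (c / cos (psi u))) (at u)"
      \<comment> \<open>Only continuity of \<open>phi\<close> is given; it is differentiable as a
        continuous right inverse of \<open>u_int k\<close>, whose derivative at \<open>phi u\<close>
        is nonzero.\<close>
      by (rule has_field_derivative_inverse_basic[OF _ _ _ U(1) uU])
        (use nz phi uU U in \<open>auto simp: continuous_on_eq_continuous_at\<close>)
    then have dphi: "(phi has_field_derivative cos (psi u) / c) (at u)" by simp
    \<comment> \<open>Differentiability of \<open>psi\<close>, which is only assumed continuous,
      comes from writing it as an explicit branch of the arcsine.\<close>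
    have Arcsin: "Arcsin (of_real k * sin (phi v)) = psi v" if "v \<in> V" for v
    proof -
      have "sin (psi v) = of_real k * sin (phi v)" "psi v \<in> B" using psi that by (auto simp: V_def)
      then show ?thesis using Arcsin_sin[of "psi v"] by (auto simp: B_def)
    qed
    have "((\<lambda>u. Arcsin (of_real k * sin (phi u))) has_field_derivative
        inverse (cos (Arcsin (of_real k * sin (phi u)))) * (of_real k * (cos (phi u) * (cos (psi u) / c)))) (at u)"
    proof (rule DERIV_chain2[OF has_field_derivative_Arcsin])
      show "\<bar>Re (of_real k * sin (phi u))\<bar> < 1" using lt1 abs_Re_le_cmod[of "of_real k * sin (phi u)"]
        unfolding sin_eq by linarith
      show "((\<lambda>u. of_real k * sin (phi u)) has_field_derivative
        of_real k * (cos (phi u) * (cos (psi u) / c))) (at u)"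
        by (auto intro!: derivative_eq_intros dphi)
    qed
    then have "(psi has_field_derivative
        inverse (cos (Arcsin (of_real k * sin (phi u)))) * (of_real k * (cos (phi u) * (cos (psi u) / c)))) (at u)"
      by (rule has_field_derivative_transform_within_open[OF _ \<open>open V\<close> u]) (rule Arcsin)
    moreover have "inverse (cos (psi u)) * (of_real k * (cos (phi u) * (cos (psi u) / c)))
        = of_real k * cos (phi u) / c"
      using nz by (simp add: field_simps)
    ultimately have dpsi: "(psi has_field_derivative of_real k * cos (phi u) / c) (at u)"
      by (simp only: Arcsin[OF u])
    have "((\<lambda>u. cos (psi u)) has_field_derivative - (sin (psi u) * (of_real k * cos (phi u) / c))) (at u)"
      by (auto intro!: derivative_eq_intros dpsi)
    also have "- (sin (psi u) * (of_real k * cos (phi u) / c)) = D' u"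
      using nz by (simp add: D'_def cs(2) s_def[symmetric])
    finally show "((\<lambda>u. cos (psi u)) has_field_derivative D' u) (at u)" .
    have "(D' has_field_derivative - 2 * of_real k * (c * (of_real k * cos (phi u) / c / 2) * cos (phi u)
        - s * (sin (phi u) * (cos (psi u) / c)))) (at u)"
      unfolding D'_def c_def s_def
      by (auto intro!: derivative_eq_intros dpsi[unfolded c_def] dphi[unfolded c_def] simp: algebra_simps)
    also have "- 2 * of_real k * (c * (of_real k * cos (phi u) / c / 2) * cos (phi u)
        - s * (sin (phi u) * (cos (psi u) / c)))
      = - ((of_real k)\<^sup>2 * (cos (phi u))\<^sup>2) + 2 * s * (of_real k * sin (phi u)) * cos (psi u) / c"
      using nz by (simp add: field_simps power2_eq_square)
    also have "\<dots> = - ((of_real k)\<^sup>2 * (cos (phi u))\<^sup>2) + 4 * s\<^sup>2 * cos (psi u)"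
      unfolding sin_eq[symmetric] cs(2) using nz by (simp add: power2_eq_square)
    \<comment> \<open>The half-angle formula removes \<open>s\<close>, and squaring
      \<open>sin psi = k * sin phi\<close> expresses \<open>k ^ 2 * cos phi ^ 2\<close> as
      \<open>k ^ 2 - 1 + cos psi ^ 2\<close>.\<close>
    also have "\<dots> = (1 - (of_real k)\<^sup>2) + 2 * cos (psi u) - 3 * (cos (psi u))\<^sup>2"
    proof -
      have "2 * s\<^sup>2 = 1 - cos (psi u)" unfolding cs(3) using cs(1) by algebra
      moreover have "(of_real k)\<^sup>2 * (cos (phi u))\<^sup>2 = (of_real k)\<^sup>2 - 1 + (cos (psi u))\<^sup>2"
        using sin_eq sin_cos_squared_add[of "psi u"] sin_cos_squared_add[of "phi u"] by algebra
      ultimately show ?thesis by algebra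
    qed
    finally show "(D' has_field_derivative (1 - (of_real k)\<^sup>2) + 2 * cos (psi u) - 3 * (cos (psi u))\<^sup>2) (at u)" .
  qed
  show thesis
  proof (rule that[OF r(1)])
    show "ball 0 r \<subseteq> U" using r(2) by (auto simp: V_def)
    show "(\<lambda>u. cos (psi u)) holomorphic_on ball 0 r"
      using main(1) r(2) by (auto simp: holomorphic_on_open)
    show "deriv (\<lambda>u. cos (psi u)) 0 = 0"
      using DERIV_imp_deriv[OF main(1)[OF \<open>0 \<in> V\<close>]] psi(2) by (simp add: D'_def)
    fix u :: complex assume "u \<in> ball 0 r"
    then have u: "u \<in> V" using r(2) by blast
    have "(deriv (\<lambda>u. cos (psi u)) has_field_derivative
        (1 - (of_real k)\<^sup>2) + 2 * cos (psi u) - 3 * (cos (psi u))\<^sup>2) (at u)"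
      by (rule has_field_derivative_transform_within_open[OF main(2)[OF u] \<open>open V\<close> u])
        (simp add: DERIV_imp_deriv[OF main(1)])
    then show "deriv (deriv (\<lambda>u. cos (psi u))) u =
       (1 - (of_real k)\<^sup>2) + 2 * cos (psi u) - 3 * (cos (psi u))\<^sup>2"
      by (rule DERIV_imp_deriv)
  qed
qed

section \<open>Matching \<open>cos psi\<close> with a translated Weierstrass function\<close>

context rect_lattice
begin

text \<open>Substituting \<open>F = 1/3 - 2 * wp\<close> into
  \<open>wp'' = 6 * wp ^ 2 - 30 * G4\<close> gives
  \<open>F'' = (60 * G4 - 1/3) + 2 * F - 3 * F ^ 2\<close>. The value -1/3 at the half period
  \<open>b\<close> gives \<open>F 0 = 1\<close> and \<open>b\<close> is a critical point, so
  uniqueness applies.\<close>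

lemma eq_affine_wp_near_0:
  assumes r: "r > 0" and D: "D holomorphic_on ball 0 r" "D 0 = 1" "deriv D 0 = 0"
    and ode: "\<And>u. u \<in> ball 0 r \<Longrightarrow> deriv (deriv D) u = a + 2 * D u - 3 * (D u)\<^sup>2"
    and G4: "60 * G4 = a + 1 / 3"
    and b: "2 * b \<in> L" "b \<notin> L" "wp b = - 1 / 3"
  shows "eventually (\<lambda>u. D u = 1 / 3 - 2 * wp (u + b)) (at 0)"
proof -
  obtain r' where r': "r' > 0" "\<And>z. z \<in> ball 0 r' \<Longrightarrow> z + b \<notin> L"
    using ball_shift_disjoint_L[OF b(2)] by blast
  define R where "R = min r r'"
  have R: "R > 0" "ball 0 R \<subseteq> ball 0 r" "\<And>z. z \<in> ball 0 R \<Longrightarrow> z + b \<notin> L"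
    using r r' by (auto simp: R_def)
  define F where "F u = 1 / 3 - 2 * wp (u + b)" for u
  have F1: "(F has_field_derivative - 2 * wp' (u + b)) (at u)" if "u + b \<notin> L" for u
    unfolding F_def using that by (auto intro!: derivative_eq_intros)
  have F2: "(deriv F has_field_derivative - 2 * wp'' (u + b)) (at u)" if "u \<in> ball 0 R" for u
  proof (rule has_field_derivative_transform_within_open[OF _ open_ball that])
    show "((\<lambda>u. - 2 * wp' (u + b)) has_field_derivative - 2 * wp'' (u + b)) (at u)"
      using R(3)[OF that] by (auto intro!: derivative_eq_intros)
  qed (use DERIV_imp_deriv[OF F1[OF R(3)]] in auto)
  have "F u = D u" if u: "u \<in> ball 0 R" for u
  proof (rule second_order_ode_unique[where f = F and g = D])
    show "F holomorphic_on ball 0 R" 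
      unfolding holomorphic_on_open[OF open_ball] using F1[OF R(3)] by blast
    show "D holomorphic_on ball 0 R" using D(1) R(2) by (rule holomorphic_on_subset)
    show "F 0 = D 0" using b D by (simp add: F_def)
    show "deriv F 0 = deriv D 0"
      using DERIV_imp_deriv[OF F1[OF R(3)]] R(1) D(3) wp'_half_period_eq_0[OF b(1,2)] by simp
    show "deriv (deriv D) z = a + 2 * D z + (- 3) * (D z)\<^sup>2" if "z \<in> ball 0 R" for z
      using ode[OF subsetD[OF R(2) that]] by simp
    show "deriv (deriv F) z = a + 2 * F z + (- 3) * (F z)\<^sup>2" if "z \<in> ball 0 R" for z
    proof -
      have "deriv (deriv F) z = - 12 * (wp (z + b))\<^sup>2 + 60 * G4"
        using DERIV_imp_deriv[OF F2[OF that]] by (simp add: wp''_eq[OF R(3)[OF that]])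
      also have "\<dots> = a + 2 * F z + (- 3) * (F z)\<^sup>2"
        unfolding G4 F_def by (simp add: power2_eq_square algebra_simps)
      finally show ?thesis .
    qed
  qed (use u in auto)
  then show ?thesis
    using R(1) unfolding F_def
    by (intro eventually_at_in_open'[THEN eventually_mono, of "ball 0 R"]) auto
qed

end

section \<open>Poles, values and multiplicities of \<open>d\<close>\<close>

theorem theorem6:
  fixes k w w' :: real
    and U :: "complex set"
    and phi psi d :: "complex \<Rightarrow> complex"
  assumes k: "0 < k" "k < 1"
    and U: "open U" "0 \<in> U"
    and phi: "continuous_on U phi" "phi 0 = 0" "\<forall>u\<in>U. u_int k (phi u) = u"
    and psi: "continuous_on U psi" "psi 0 = 0"
             "\<forall>u\<in>U. sin (psi u) = complex_of_real k * sin (phi u)"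
    and d: "elliptic_fun d" "\<forall>u\<in>U. d u = cos (psi u)"
    and w: "0 < w" "0 < w'"
    and g: "lattice_g2 (lattice w w') = 4/3 - (complex_of_real k)\<^sup>2"
           "lattice_g3 (lattice w w') = 8/27 - (complex_of_real k)\<^sup>2 / 3"
  shows "is_pole d (\<i> * complex_of_real w') \<and> zorder d (\<i> * complex_of_real w') = -2
       \<and> (\<forall>z. is_pole d z \<longleftrightarrow> z - \<i> * complex_of_real w' \<in> lattice w w')
       \<and> d (complex_of_real w + \<i> * complex_of_real w') = - complex_of_real (sqrt (1 - k\<^sup>2))
       \<and> zorder (\<lambda>z. d z + complex_of_real (sqrt (1 - k\<^sup>2))) (complex_of_real w + \<i> * complex_of_real w') = 2
       \<and> d (complex_of_real w) = complex_of_real (sqrt (1 - k\<^sup>2))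
       \<and> zorder (\<lambda>z. d z - complex_of_real (sqrt (1 - k\<^sup>2))) (complex_of_real w) = 2"
proof -
  interpret rect_lattice w w' using w by unfold_locales
  define l where "l = sqrt (1 - k\<^sup>2)"
  have "k\<^sup>2 < 1" using k by (simp add: power_less_one_iff)
  then have l: "l\<^sup>2 = 1 - k\<^sup>2" "0 < l" by (auto simp: l_def)
  have "l\<^sup>2 < 1\<^sup>2" using l k by simp
  then have l1: "l < 1" using power2_less_imp_less by fastforce
  define e1 e2 e3 :: real where "e1 = 1/6 + l/2" and "e2 = 1/6 - l/2" and "e3 = -1/3"
  \<comment> \<open>The gap \<open>e1 - e2\<close> is \<open>l\<close>, and \<open>e2 - e3\<close>
    is \<open>(1 - l) / 2\<close>; both are positive because \<open>l\<close> lies strictly between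
    0 and 1.\<close>
  have ord: "e3 < e2" "e2 < e1" and sum0: "e1 + e2 + e3 = 0"
    using l l1 by (auto simp: e1_def e2_def e3_def)
  have "- 4 * (e1 * e2 + e1 * e3 + e2 * e3) = 1/3 + l\<^sup>2" "4 * (e1 * e2 * e3) = - 1/27 + l\<^sup>2 / 3"
    by (simp_all add: e1_def e2_def e3_def power2_eq_square algebra_simps)
  then have e: "- 4 * (e1 * e2 + e1 * e3 + e2 * e3) = 4/3 - k\<^sup>2" "4 * (e1 * e2 * e3) = 8/27 - k\<^sup>2 / 3"
    unfolding l by (simp_all add: field_simps)
  have g2: "60 * G4 = - 4 * of_real (e1 * e2 + e1 * e3 + e2 * e3)"
    using g(1) arg_cong[OF e(1), of complex_of_real] by (simp add: lattice_g2_def)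
  have g3: "140 * G6 = 4 * of_real (e1 * e2 * e3)"
    using g(2) arg_cong[OF e(2), of complex_of_real] by (simp add: lattice_g3_def)
  note hyps = ord sum0 g2 g3
  define v where "v = complex_of_real w"
  define v' where "v' = \<i> * complex_of_real w'"
  have in_L: "2 * v \<in> L" "2 * v' \<in> L" "2 * (v + v') \<in> L"
    using add_in_L[of "2 * v" "2 * v'"] by (simp_all add: v_def v'_def)
  have notin_L: "v \<notin> L" "v' \<notin> L" "v + v' \<notin> L"
    by (auto simp: v_def v'_def intro!: half_not_in_L)
  have vals: "wp v = of_real e1" "wp v' = of_real e3" "wp (v + v') = of_real e2"
    using wp_w[OF hyps] wp_iw'[OF hyps] wp_w_iw'[OF hyps] by (simp_all add: v_def v'_def)
  define F where "F z = 1 / 3 - 2 * wp (z + v')" for z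

  obtain r where r: "r > 0" "ball 0 r \<subseteq> U" "(\<lambda>u. cos (psi u)) holomorphic_on ball 0 r"
    "deriv (\<lambda>u. cos (psi u)) 0 = 0"
    "\<And>u. u \<in> ball 0 r \<Longrightarrow> deriv (deriv (\<lambda>u. cos (psi u))) u =
       (1 - (of_real k)\<^sup>2) + 2 * cos (psi u) - 3 * (cos (psi u))\<^sup>2"
    using cos_psi_ode[OF U phi psi] by blast
  have "eventually (\<lambda>u. cos (psi u) = F u) (at 0)"
    unfolding F_def
    \<comment> \<open>The constant matches: \<open>4/3 - k ^ 2\<close> is
      \<open>(1 - k ^ 2) + 1/3\<close>.\<close>
    by (rule eq_affine_wp_near_0[OF r(1,3) _ r(4,5)])
      (use psi in_L notin_L vals g(1) in \<open>auto simp: e3_def lattice_g2_def\<close>)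
  moreover have "eventually (\<lambda>u. u \<in> U) (at 0)"
    using U by (rule eventually_at_in_open')
  ultimately have "eventually (\<lambda>u. d u = F u) (at 0)"
    by eventually_elim (use d(2) in auto)
  moreover have nice: "d nicely_meromorphic_on UNIV" using d(1) by (simp add: elliptic_fun_def)
  moreover have "F meromorphic_on UNIV"
    unfolding F_def by (intro meromorphic_intros meromorphic_wp_shift)
  ultimately have ev: "eventually (\<lambda>u. d u = F u) (at z)" for z
    using meromorphic_identity[of d F 0 z] by (simp add: nicely_meromorphic_on_def)

  have F_analytic: "F analytic_on {z}" if "z + v' \<notin> L" for z
  proof -
    have "wp \<circ> (\<lambda>z. z + v') analytic_on {z}"
      by (rule analytic_on_compose) (use that in \<open>auto intro!: analytic_intros wp_analytic_at\<close>)
    then show ?thesis unfolding F_def by (auto simp: o_def intro!: analytic_intros)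
  qed
  have zorder_F: "zorder F z = - 2" if "z + v' \<in> L" for z
    using wp_at_lattice(3)[OF that, of "-2" "1/3"] zorder_comp_shift[of "\<lambda>z. 1/3 + (- 2) * wp z" v' z]
    by (simp add: F_def[abs_def])
  have pole_iff: "is_pole d z \<longleftrightarrow> z + v' \<in> L" for z
  proof -
    have "is_pole d z \<longleftrightarrow> is_pole F z" by (rule is_pole_cong[OF ev refl])
    also have "\<dots> \<longleftrightarrow> z + v' \<in> L"
    proof
      assume "is_pole F z"
      then show "z + v' \<in> L" using F_analytic analytic_at_imp_no_pole by blast
    next
      assume "z + v' \<in> L"
      then have "is_pole (\<lambda>z. wp (z + v')) z" by (simp add: is_pole_wp_shift_iff)
      then have "filterlim (\<lambda>z. - 2 * wp (z + v')) at_infinity (at z)"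
        unfolding is_pole_def by (intro tendsto_mult_filterlim_at_infinity[OF tendsto_const]) auto
      then show "is_pole F z"
        unfolding is_pole_def F_def
        using tendsto_add_filterlim_at_infinity[OF tendsto_const, of "\<lambda>z. - 2 * wp (z + v')" "at z" "1/3"] by simp
    qed
    finally show ?thesis .
  qed
  \<comment> \<open>The points \<open>z + v'\<close> and \<open>z - v'\<close> differ by the period
    \<open>2 * v'\<close>.\<close>
  have pole_iff': "is_pole d z \<longleftrightarrow> z - v' \<in> L" for z
    using pole_iff[of z] add_in_L_iff[OF in_L(2), of "z - v'"] by (simp add: add.commute)
  \<comment> \<open>Agreement in punctured neighbourhoods says nothing about the point itself; nice
    meromorphy makes \<open>d z\<close> its own limit wherever there is no pole.\<close>
  have d_eq: "d z = F z" if "z + v' \<notin> L" for z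
  proof -
    have "d \<midarrow>z\<rightarrow> d z" using nice pole_iff[of z] that by (auto simp: nicely_meromorphic_on_def)
    moreover have "d \<midarrow>z\<rightarrow> F z"
      using F_analytic[OF that] tendsto_cong[OF ev[of z]] by (simp add: analytic_at_imp_isCont isContD)
    ultimately show ?thesis by (rule LIM_unique)
  qed
  \<comment> \<open>Near \<open>a\<close> the difference is -2 times the increment of
    \<open>wp\<close> at the half period \<open>a + v'\<close>, where the order is known to be
    2.\<close>
  have zorder_value: "zorder (\<lambda>z. d z - d a) a = 2" if a: "2 * (a + v') \<in> L" "a + v' \<notin> L" for a
  proof -
    have "eventually (\<lambda>z. d z - d a = - 2 * (wp (z + v') - wp (a + v'))) (at a)"
      using ev[of a] by eventually_elim (simp add: d_eq[OF a(2)] F_def)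
    then have "zorder (\<lambda>z. d z - d a) a = zorder (\<lambda>z. - 2 * (wp (z + v') - wp (a + v'))) a"
      by (rule zorder_cong) simp
    also have "\<dots> = zorder (\<lambda>z. wp z - wp (a + v')) (a + v')"
      by (subst zorder_cmult) (simp_all add: zorder_comp_shift[of "\<lambda>z. wp z - wp (a + v')"])
    also have "\<dots> = 2" by (rule zorder_wp_half_period[OF hyps a])
    finally show ?thesis .
  qed
  \<comment> \<open>Translation by \<open>v'\<close> sends \<open>v + v'\<close> to a point
    congruent to \<open>v\<close>, so \<open>d\<close> has the value
    \<open>1/3 - 2 * e1 = - l\<close> there; it sends \<open>v\<close> to \<open>v + v'\<close>,
    which gives \<open>1/3 - 2 * e2 = l\<close>.\<close>
  have vv': "v + v' + v' = v + 2 * v'" by simp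
  have wp_vv': "wp (v + v' + v') = of_real e1" "v + v' + v' \<notin> L"
    unfolding vv' using wp_periodic[OF in_L(2) notin_L(1)] vals notin_L add_in_L_iff[OF in_L(2)] by auto
  have d1: "d (v + v') = - of_real l" using d_eq[OF wp_vv'(2)] unfolding F_def wp_vv'(1) by (simp add: e1_def)
  have d2: "d v = of_real l" using d_eq[OF notin_L(3)] by (simp add: F_def vals e2_def)
  have z1: "zorder (\<lambda>z. d z + of_real l) (v + v') = 2"
  proof -
    have "2 * (v + v' + v') \<in> L" using add_in_L[OF in_L(3,2)] by (simp add: algebra_simps)
    from zorder_value[OF this wp_vv'(2)] show ?thesis by (simp add: d1)
  qed
  have z2: "zorder (\<lambda>z. d z - of_real l) v = 2"
    using zorder_value[OF in_L(3) notin_L(3)] by (simp add: d2)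
  have "is_pole d v'" "zorder d v' = - 2"
    using pole_iff'[of v'] zorder_cong[OF ev[of v'] refl] zorder_F[of v'] in_L(2) by auto
  with pole_iff' d1 d2 z1 z2 show ?thesis
    unfolding l_def v_def v'_def by blast
qed

end
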